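(* Let $\alpha\in(1,2)$, let $\psi(x)=\exp(-\|x\|^2)$ for $x\in\mathbb{R}^d$, and let $g_{R,j}(x)=x_j\,\psi(x/R)$ for $x\in\mathbb{R}^d$, $R\ge1$ and $j\in\{1,\dots,d\}$. Let $X$ be a centered random vector of $\mathbb{R}^d$ with finite first moment, with law $\mu$ and such that, for all $j\in\{1,\dots,d\}$, $$\lim_{R\to+\infty}\Big(\operatorname{Var}(g_{R,j}(X))-\mathbb{E}\int_{\mathbb{R}^d}|g_{R,j}(X+u)-g_{R,j}(X)|^2\nu_\alpha(du)\Big)=0.$$ If $U_\alpha(\mu)=1$, then $\mu=\mu_\alpha$, where $\mu_\alpha$ is the law of the rotationally invariant $\alpha$-stable random vector with characteristic function $\exp(-\|\xi\|^\alpha/2)$, $\xi\in\mathbb{R}^d$.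
   Context: $\|\cdot\|$: Euclidean norm on $\mathbb{R}^d$. $\nu_\alpha(du)=\frac{c_{\alpha,d}}{\|u\|^{d+\alpha}}du$ with $c_{\alpha,d}=\frac{-\alpha(\alpha-1)\Gamma((\alpha+d)/2)}{4\cos(\alpha\pi/2)\Gamma((\alpha+1)/2)\pi^{(d-1)/2}\Gamma(2-\alpha)}$ ($\Gamma$ is Euler's Gamma function) is the Lévy measure of $\mu_\alpha$. For a probability measure $\mu$ on $\mathbb{R}^d$ and $X\sim\mu$, $$U_\alpha(\mu)=\sup_{f\in\mathcal{H}_\alpha}\frac{\operatorname{Var}(f(X))}{\mathbb{E}\int_{\mathbb{R}^d}|f(X+u)-f(X)|^2\nu_\alpha(du)},$$ where $\mathcal{H}_\alpha$ is the set of (Borel measurable) functions $f:\mathbb{R}^d\to\mathbb{R}$ such that $\operatorname{Var}(f(X))<+\infty$ and $0<\mathbb{E}\int_{\mathbb{R}^d}|f(X+u)-f(X)|^2\nu_\alpha(du)<+\infty$. Centered means $\mathbb{E}X=0$. *)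

theory Defs
  imports "HOL-Probability.Probability"
begin

text \<open>
  The space \<open>\<real>\<^sup>d\<close> is \<open>real ^ 'd\<close>, so \<open>d = CARD('d)\<close>; its Borel probability measures are the
  measures \<open>\<mu>\<close> with \<open>prob_space \<mu>\<close> and \<open>sets \<mu> = sets borel\<close>.
\<close>

definition stable_const :: "real \<Rightarrow> nat \<Rightarrow> real" where
  "stable_const \<alpha> d =
     - \<alpha> * (\<alpha> - 1) * Gamma ((\<alpha> + real d) / 2) /
     (4 * cos (\<alpha> * pi / 2) * Gamma ((\<alpha> + 1) / 2) * pi powr ((real d - 1) / 2) * Gamma (2 - \<alpha>))"

text \<open>
  The density takes the value \<open>0\<close> at the origin (division by zero), which is a Lebesgue null set.
  For \<open>1 < \<alpha> < 2\<close> we have \<open>cos (\<alpha> * pi / 2) < 0\<close>, so the density is nonnegative and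
  \<open>ennreal\<close> does not truncate it.
\<close>

definition stable_levy :: "real \<Rightarrow> (real ^ 'd) measure" where
  "stable_levy \<alpha> = density lborel
     (\<lambda>u. ennreal (stable_const \<alpha> CARD('d) / norm u powr (real CARD('d) + \<alpha>)))"

definition energy :: "real \<Rightarrow> (real ^ 'd) measure \<Rightarrow> (real ^ 'd \<Rightarrow> real) \<Rightarrow> ennreal" where
  "energy \<alpha> \<mu> f = (\<integral>\<^sup>+ x. (\<integral>\<^sup>+ u. ennreal (\<bar>f (x + u) - f x\<bar>\<^sup>2) \<partial>stable_levy \<alpha>) \<partial>\<mu>)"

definition finite_variance :: "'a measure \<Rightarrow> ('a \<Rightarrow> real) \<Rightarrow> bool" where
  "finite_variance \<mu> f \<longleftrightarrow>
     integrable \<mu> f \<and> integrable \<mu> (\<lambda>x. (f x - prob_space.expectation \<mu> f)\<^sup>2)"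

definition H_class :: "real \<Rightarrow> (real ^ 'd) measure \<Rightarrow> (real ^ 'd \<Rightarrow> real) set" where
  "H_class \<alpha> \<mu> = {f \<in> borel_measurable borel.
     finite_variance \<mu> f \<and> 0 < energy \<alpha> \<mu> f \<and> energy \<alpha> \<mu> f < \<infinity>}"

text \<open>The supremum is taken in \<open>[0, \<infinity>]\<close>, so it is \<open>\<infinity>\<close> for unbounded quotients.\<close>

definition U_functional :: "real \<Rightarrow> (real ^ 'd) measure \<Rightarrow> ennreal" where
  "U_functional \<alpha> \<mu> =
     (SUP f\<in>H_class \<alpha> \<mu>. ennreal (prob_space.variance \<mu> f) / energy \<alpha> \<mu> f)"

definition char_vec :: "(real ^ 'd) measure \<Rightarrow> real ^ 'd \<Rightarrow> complex" where
  "char_vec \<mu> \<xi> = (CLINT x|\<mu>. iexp (\<xi> \<bullet> x))"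

text \<open>
  For \<open>0 < \<alpha> \<le> 2\<close> exactly one measure satisfies the description below: it exists because
  \<open>exp (- norm \<xi> powr \<alpha> / 2)\<close> is positive definite and continuous, and it is unique because
  characteristic functions determine Borel probability measures.
\<close>

definition stable_law :: "real \<Rightarrow> (real ^ 'd) measure" where
  "stable_law \<alpha> = (THE \<mu>. prob_space \<mu> \<and> sets \<mu> = sets borel \<and>
     (\<forall>\<xi>. char_vec \<mu> \<xi> = complex_of_real (exp (- (norm \<xi> powr \<alpha>) / 2))))"

definition psi :: "real ^ 'd \<Rightarrow> real" where
  "psi x = exp (- (norm x)\<^sup>2)"

definition g_trunc :: "real \<Rightarrow> 'd \<Rightarrow> real ^ 'd \<Rightarrow> real" where
  "g_trunc R j x = x $ j * psi (x /\<^sub>R R)"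

end

theory Submission imports Defs begin

text \<open>
  If \<open>U = 1\<close>, then \<open>Q f = energy f - Var f\<close> is a nonnegative quadratic form on bounded Lipschitz
  functions, and by hypothesis \<open>Q (g_trunc R j)\<close> tends to \<open>0\<close> as \<open>R \<rightarrow> \<infinity>\<close>. Expanding
  \<open>0 \<le> Q (g_trunc R j + s h)\<close> and letting \<open>R \<rightarrow> \<infinity>\<close> for each fixed \<open>s\<close> leaves the Stein-type identity
  \<open>\<bbbE> \<integral> u\<^sub>j (h (X + u) - h X) \<nu>(du) = \<bbbE> (X\<^sub>j h X)\<close>; here \<open>1 < \<alpha> < 2\<close> makes \<open>min \<parallel>u\<parallel> \<parallel>u\<parallel>\<^sup>2\<close> integrable for
  the Levy measure, which dominates everything. With \<open>h\<close> a cosine of \<open>s w \<bullet> x\<close>, the identity says that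
  \<open>\<phi> s = \<bbbE> exp (i s w \<bullet> X)\<close> solves \<open>\<phi>' s = - (\<alpha> / 2) \<parallel>w\<parallel>\<^sup>\<alpha> s\<^sup>\<alpha>\<^sup>-\<^sup>1 \<phi> s\<close>, whence the characteristic
  function of \<open>X\<close>. The constant comes from writing \<open>\<parallel>u\<parallel>\<close> to the power \<open>- (d + \<alpha>)\<close> as a mixture of the
  Gaussian kernels \<open>exp (- t \<parallel>u\<parallel>\<^sup>2)\<close> and from the reflection and duplication formulas for \<open>Gamma\<close>.
\<close>

section \<open>Gamma integrals and Gaussian Fourier transforms\<close>

text \<open>The coordinate functions, which one would like to insert into Q directly, have infinite
  energy because \<alpha> < 2, and X need not have a second moment. They are approached through
  \<open>g_trunc\<close>, whose bound |x_j| and Lipschitz constant 3 do not depend on R. Only cross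
  terms with a fixed h then have to converge, and these are dominated: one increment is at most a
  multiple of |u|, the other at most a multiple of min 1 |u|, and the product of the two is a
  multiple of min |u| |u|^2. Since s may have either sign, a surviving linear term in s would beat
  the fixed quadratic term for small s and make the form negative; so it vanishes. A second obstacle
  is that \<open>H_class\<close> leaves out functions of zero energy, about which U says nothing;
  they turn out to be constant. Finally, \<open>stable_law\<close> is a definite description. The
  law of X itself is the witness for existence, and uniqueness is the injectivity of the Fourier
  transform on finite Borel measures, proved by Gaussian smoothing.\<close>

lemma gamma_has_integral_scaled:
  fixes a r :: real
  assumes "a > 0" "r > 0"
  shows "((\<lambda>t. t powr (a - 1) * exp (- r * t)) has_integral Gamma a * r powr (- a)) {0<..}"
proof -
  have *: "((\<lambda>t. \<bar>r\<bar> * ((r * t) powr (a - 1) / exp (r * t))) has_integral Gamma a) {0<..}"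
  proof -
    \<comment> \<open>The standard Gamma integral runs over the closed half-line. Changing the
      integrand on the null set {0} gives the open one, which scaling maps onto itself.\<close>
    have "((\<lambda>t. if t \<in> {0<..} then t powr (a - 1) / exp t else 0) has_integral Gamma a) {0..}"
      by (rule has_integral_spike[OF _ _ Gamma_integral_real[OF assms(1)], of "{0}"]) auto
    hence g: "((\<lambda>t. t powr (a - 1) / exp t) has_integral Gamma a) {0<..}"
      by (subst (asm) has_integral_restrict) auto
    hence abs: "(\<lambda>t. t powr (a - 1) / exp t) absolutely_integrable_on {0<..}"
      by (intro nonnegative_absolutely_integrable_1) (auto simp: has_integral_integrable)
    have im: "(*) r ` {0<..} = {0<..}"
      using assms by (auto simp: image_iff intro!: bexI[of _ "_ / r"])
    have "(\<lambda>t. \<bar>r\<bar> * ((r * t) powr (a - 1) / exp (r * t))) absolutely_integrable_on {0<..} \<and>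
      integral {0<..} (\<lambda>t. \<bar>r\<bar> * ((r * t) powr (a - 1) / exp (r * t))) = Gamma a"
      using abs g assms
      by (subst has_absolute_integral_change_of_variables_1'[where g = "(*) r"])
         (auto simp: im inj_on_def integral_unique intro!: derivative_eq_intros)
    thus ?thesis
      using has_integral_iff set_lebesgue_integral_eq_integral(1) by blast
  qed
  have "((\<lambda>t. r powr (- a) * (\<bar>r\<bar> * ((r * t) powr (a - 1) / exp (r * t)))) has_integral r powr (- a) * Gamma a) {0<..}"
    by (rule has_integral_mult_right[OF *])
  moreover have "r powr (- a) * (\<bar>r\<bar> * ((r * t) powr (a - 1) / exp (r * t))) = t powr (a - 1) * exp (- r * t)"
    if "t \<in> {0<..}" for t
    using that assms
    by (simp add: powr_mult exp_minus powr_minus powr_diff field_simps)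
  ultimately show ?thesis
    by (subst mult.commute[of "Gamma a"]) (rule has_integral_eq[rotated])
qed

lemma gamma_nn_integral:
  fixes a r :: real
  assumes "a > 0" "r > 0"
  shows "(\<integral>\<^sup>+t\<in>{0<..}. ennreal (t powr (a - 1) * exp (- r * t)) \<partial>lborel) = ennreal (Gamma a * r powr (- a))"
proof -
  have "integral\<^sup>N lborel (\<lambda>t. indicator {0<..} t * ennreal (t powr (a - 1) * exp (- r * t))) = ennreal (Gamma a * r powr (- a))"
    using nn_integral_has_integral_lebesgue[OF _ gamma_has_integral_scaled[OF assms]]
    by (simp add: ennreal_mult' ennreal_indicator mult.assoc[symmetric])
  thus ?thesis by (simp add: mult.commute)
qed

text \<open>The substitution t -> 1/t, with Jacobian t^-2, reduces this to the Gamma integral. The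
  factor exp (- r / t) is what a Gaussian of rate t leaves behind after its Fourier transform is
  taken.\<close>

lemma inverse_gamma_nn_integral:
  fixes b r :: real
  assumes "b > 0" "r > 0"
  shows "(\<integral>\<^sup>+t\<in>{0<..}. ennreal (t powr (- b - 1) * exp (- r / t)) \<partial>lborel) = ennreal (Gamma b * r powr (- b))"
proof -
  have g: "((\<lambda>t. t powr (b - 1) * exp (- r * t)) has_integral Gamma b * r powr (- b)) {0<..}"
    by (rule gamma_has_integral_scaled[OF assms])
  hence abs: "(\<lambda>t. t powr (b - 1) * exp (- r * t)) absolutely_integrable_on {0<..}"
    by (intro nonnegative_absolutely_integrable_1) (auto simp: has_integral_integrable)
  have im: "inverse ` {0::real<..} = {0<..}"
    by (auto simp: image_iff intro!: bexI[of _ "inverse _"])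
  have "(\<lambda>t. \<bar>- inverse (t ^ 2)\<bar> * (inverse t powr (b - 1) * exp (- r * inverse t))) absolutely_integrable_on {0<..} \<and>
      integral {0<..} (\<lambda>t. \<bar>- inverse (t ^ 2)\<bar> * (inverse t powr (b - 1) * exp (- r * inverse t))) = Gamma b * r powr (- b)"
    using abs g assms
    by (subst has_absolute_integral_change_of_variables_1'[where g = inverse])
       (auto simp: im inj_on_def integral_unique power2_eq_square intro!: derivative_eq_intros)
  hence "((\<lambda>t. \<bar>- inverse (t ^ 2)\<bar> * (inverse t powr (b - 1) * exp (- r * inverse t))) has_integral Gamma b * r powr (- b)) {0<..}"
    using has_integral_iff set_lebesgue_integral_eq_integral(1) by blast
  moreover have "\<bar>- inverse (t ^ 2)\<bar> * (inverse t powr (b - 1) * exp (- r * inverse t)) = t powr (- b - 1) * exp (- r / t)"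
    if "t \<in> {0<..}" for t
  proof -
    have "inverse (t ^ 2) * inverse t powr (b - 1) = t powr (- 2 + (1 - b))"
      unfolding powr_add
      using that by (simp add: powr_minus powr_numeral inverse_powr powr_powr) (simp add: powr_minus[symmetric])
    also have "- 2 + (1 - b) = - b - 1" by simp
    finally show ?thesis using that by (simp add: field_simps)
  qed
  ultimately have h: "((\<lambda>t. t powr (- b - 1) * exp (- r / t)) has_integral Gamma b * r powr (- b)) {0<..}"
    by (rule has_integral_eq[rotated])
  have "integral\<^sup>N lborel (\<lambda>t. indicator {0<..} t * ennreal (t powr (- b - 1) * exp (- r / t))) = ennreal (Gamma b * r powr (- b))"
    using nn_integral_has_integral_lebesgue[OF _ h]
    by (simp add: ennreal_mult' ennreal_indicator mult.assoc[symmetric])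
  thus ?thesis by (simp add: mult.commute)
qed

text \<open>Excludes the poles of \<open>Gamma\<close> at arguments such as (1 - \<alpha>) / 2,
  which is negative but larger than -1.\<close>

lemma not_nonpos_Int_between:
  fixes x :: real
  assumes "-1 < x" "x \<noteq> 0"
  shows "x \<notin> \<int>\<^sub>\<le>\<^sub>0"
proof
  assume "x \<in> \<int>\<^sub>\<le>\<^sub>0"
  then obtain n where "x = of_int n" "n \<le> 0" by (auto elim!: nonpos_Ints_cases)
  with assms show False by (cases "n = 0") auto
qed

text \<open>The left side is the constant that remains after the Gaussian mixture has been
  integrated. Duplication at 1 - \<alpha> / 2 brings in Gamma (2 - \<alpha>), reflection at
  (\<alpha> + 1) / 2 brings in the cosine, and one shift of the argument joins the two. The power of
  2 on the right later cancels against (|xi| / 2)^\<alpha>.\<close>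

lemma stable_const_identity:
  fixes \<alpha> :: real
  assumes "1 < \<alpha>" "\<alpha> < 2"
  shows "stable_const \<alpha> d / Gamma ((\<alpha> + real d) / 2) * pi powr (real d / 2) * Gamma (1 - \<alpha> / 2)
           = \<alpha> * 2 powr (\<alpha> - 2)"
proof -
  have cos: "cos (\<alpha> * pi / 2) < 0"
    using assms by (intro cos_lt_zero_pi) (auto simp: field_simps)
  have dup: "Gamma (1 - \<alpha> / 2) * Gamma ((3 - \<alpha>) / 2) = 2 powr (\<alpha> - 1) * sqrt pi * Gamma (2 - \<alpha>)"
  proof -
    define z where "z = 1 - \<alpha> / 2"
    have z: "z > 0" using assms by (simp add: z_def)
    have "complex_of_real z \<notin> \<int>\<^sub>\<le>\<^sub>0" "complex_of_real z + 1 / 2 \<notin> \<int>\<^sub>\<le>\<^sub>0"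
      using z by (auto elim!: nonpos_Ints_cases simp: complex_eq_iff)
    from Gamma_legendre_duplication[OF this]
    \<comment> \<open>The duplication formula is used over the complex numbers; all quantities are
      real, so injectivity of \<open>of_real\<close> brings it back.\<close>
    have "complex_of_real (Gamma z * Gamma (z + 1 / 2)) =
            complex_of_real (exp ((1 - 2 * z) * ln 2) * sqrt pi * Gamma (2 * z))"
      using z
      by (simp add: Gamma_complex_of_real[symmetric] exp_of_real[symmetric])
    hence "Gamma z * Gamma (z + 1 / 2) = exp ((1 - 2 * z) * ln 2) * sqrt pi * Gamma (2 * z)"
      using of_real_eq_iff by blast
    moreover have "z + 1 / 2 = (3 - \<alpha>) / 2" "2 * z = 2 - \<alpha>"
      by (simp_all add: z_def field_simps)
    moreover have "exp ((1 - 2 * z) * ln 2) = 2 powr (\<alpha> - 1)" by (simp add: powr_def z_def)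
    ultimately show ?thesis by (simp only: z_def)
  qed
  have refl: "Gamma ((\<alpha> + 1) / 2) * Gamma ((1 - \<alpha>) / 2) = pi / cos (\<alpha> * pi / 2)"
  proof -
    define z where "z = (\<alpha> + 1) / 2"
    have z: "z \<notin> \<int>\<^sub>\<le>\<^sub>0" "1 - z \<notin> \<int>\<^sub>\<le>\<^sub>0"
      by (rule not_nonpos_Int_between; use assms in \<open>auto simp: z_def field_simps\<close>)+
    have "complex_of_real (Gamma z * Gamma (1 - z)) = complex_of_real (pi / sin (pi * z))"
      using Gamma_reflection_complex[of z] z
      by (simp add: Gamma_complex_of_real[symmetric] sin_of_real[symmetric])
    hence "Gamma z * Gamma (1 - z) = pi / sin (pi * z)"
      using of_real_eq_iff by blast
    moreover have "sin (pi * z) = cos (\<alpha> * pi / 2)"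
    proof -
      have "pi * z = \<alpha> * pi / 2 + pi / 2" by (simp add: z_def field_simps)
      thus ?thesis by (simp only: sin_add) simp
    qed
    moreover have "1 - z = (1 - \<alpha>) / 2" by (simp add: z_def field_simps)
    ultimately have "Gamma z * Gamma ((1 - \<alpha>) / 2) = pi / cos (\<alpha> * pi / 2)" by (simp only:)
    thus ?thesis by (simp only: z_def)
  qed
  \<comment> \<open>(3 - \<alpha>) / 2 is (1 - \<alpha>) / 2 + 1, so the second factor of the
    duplication formula is tied to the second factor of the reflection formula.\<close>
  have shift: "Gamma ((3 - \<alpha>) / 2) = (1 - \<alpha>) / 2 * Gamma ((1 - \<alpha>) / 2)"
  proof -
    have "(1 - \<alpha>) / 2 \<notin> \<int>\<^sub>\<le>\<^sub>0"
      by (rule not_nonpos_Int_between) (use assms in \<open>auto simp: field_simps\<close>)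
    from Gamma_plus1[OF this] show ?thesis by (simp add: field_simps)
  qed
  have pos: "Gamma ((\<alpha> + real d) / 2) > 0" "Gamma ((\<alpha> + 1) / 2) > 0" "Gamma (2 - \<alpha>) > 0"
    "Gamma ((3 - \<alpha>) / 2) > 0"
    using assms by (auto intro!: Gamma_real_pos)
  define C where "C = cos (\<alpha> * pi / 2)"
  define A where "A = Gamma ((\<alpha> + 1) / 2)"
  define B where "B = Gamma ((1 - \<alpha>) / 2)"
  define E where "E = Gamma (2 - \<alpha>)"
  have C0: "C \<noteq> 0" and E0: "E \<noteq> 0" using cos pos by (auto simp: C_def E_def)
  have AB: "A * B = pi / C" using refl by (simp add: A_def B_def C_def)
  hence AB0: "A \<noteq> 0" "B \<noteq> 0" using C0 by auto
  have pip: "pi powr (real d / 2) = pi powr ((real d - 1) / 2) * sqrt pi"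
    by (simp add: powr_half_sqrt[symmetric] powr_add[symmetric] add_divide_distrib[symmetric])
  have G: "Gamma (1 - \<alpha> / 2) = 2 powr (\<alpha> - 1) * sqrt pi * E / ((1 - \<alpha>) / 2 * B)"
  proof (subst eq_divide_eq, subst if_P)
    show "(1 - \<alpha>) / 2 * B \<noteq> 0" using shift pos(4) by (auto simp: B_def)
    show "Gamma (1 - \<alpha> / 2) * ((1 - \<alpha>) / 2 * B) = 2 powr (\<alpha> - 1) * sqrt pi * E"
      using dup unfolding shift B_def E_def .
  qed
  have p2: "2 powr (\<alpha> - 1) = 2 * 2 powr (\<alpha> - 2)"
    using powr_add[of 2 1 "\<alpha> - 2"] by simp
  define G0 where "G0 = Gamma ((\<alpha> + real d) / 2)"
  define P where "P = pi powr ((real d - 1) / 2)"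
  have nz: "G0 \<noteq> 0" "P \<noteq> 0" using pos by (auto simp: G0_def P_def)
  have "stable_const \<alpha> d / G0 * (P * sqrt pi) * (2 powr (\<alpha> - 1) * sqrt pi * E / ((1 - \<alpha>) / 2 * B))
     = - \<alpha> * (\<alpha> - 1) * G0 / (4 * C * A * P * E) / G0 * (P * sqrt pi) * (2 * 2 powr (\<alpha> - 2) * sqrt pi * E / ((1 - \<alpha>) / 2 * B))"
    by (simp add: stable_const_def C_def A_def E_def G0_def P_def p2)
  also have "\<dots> = \<alpha> * 2 powr (\<alpha> - 2) * (sqrt pi * sqrt pi) / (C * (A * B))"
  proof -
    define D where "D = \<alpha> - 1"
    have D: "D \<noteq> 0" "1 - \<alpha> = - D" "\<alpha> - 1 = D" using assms by (auto simp: D_def)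
    show ?thesis unfolding D(2,3) using nz C0 E0 AB0 D(1) by (simp add: field_simps)
  qed
  also have "\<dots> = \<alpha> * 2 powr (\<alpha> - 2)"
    using C0 by (simp add: AB)
  finally show ?thesis unfolding pip G G0_def P_def .
qed

section \<open>Fourier transforms of Gaussian kernels\<close>

lemma gaussian_fourier_real:
  fixes t \<xi> :: real
  assumes "t > 0"
  shows "has_bochner_integral lborel (\<lambda>x. of_real (exp (- t * x\<^sup>2)) * iexp (\<xi> * x))
           (complex_of_real (sqrt (pi / t) * exp (- \<xi>\<^sup>2 / (4 * t))))"
proof -
  \<comment> \<open>With this scale (c x)^2 / 2 = t x^2, so the kernel is a rescaled standard normal
    density and its transform is the known characteristic function at the frequency \<xi> /
    c.\<close>
  define c where "c = sqrt (2 * t)"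
  have c: "c > 0" "c\<^sup>2 = 2 * t" using assms by (auto simp: c_def)
  define u where "u = \<xi> / c"
  have int: "integrable lborel (\<lambda>x. std_normal_density x *\<^sub>R iexp (u * x))"
  proof (rule Bochner_Integration.integrable_bound)
    show "integrable lborel std_normal_density"
      using integrable_std_normal_moment[of 0] by simp
  qed (auto simp: norm_mult)
  have "(CLINT x|lborel. std_normal_density x *\<^sub>R iexp (u * x)) = char std_normal_distribution u"
    unfolding char_def by (subst integral_density) auto
  hence "has_bochner_integral lborel (\<lambda>x. std_normal_density x *\<^sub>R iexp (u * x)) (complex_of_real (exp (- (u\<^sup>2) / 2)))"
    using int by (simp add: has_bochner_integral_iff char_std_normal_distribution)
  hence "has_bochner_integral lborel (\<lambda>x. std_normal_density (0 + c * x) *\<^sub>R iexp (u * (0 + c * x)))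
      (complex_of_real (exp (- (u\<^sup>2) / 2)) /\<^sub>R \<bar>c\<bar>)"
    using c by (subst (asm) lborel_has_bochner_integral_real_affine_iff[of c _ _ 0]) auto
  hence "has_bochner_integral lborel (\<lambda>x. complex_of_real (sqrt (2 * pi)) * (std_normal_density (0 + c * x) *\<^sub>R iexp (u * (0 + c * x))))
      (complex_of_real (sqrt (2 * pi)) * (complex_of_real (exp (- (u\<^sup>2) / 2)) /\<^sub>R \<bar>c\<bar>))"
    by (intro has_bochner_integral_mult_right)
  moreover have "complex_of_real (sqrt (2 * pi)) * (std_normal_density (0 + c * x) *\<^sub>R iexp (u * (0 + c * x)))
      = of_real (exp (- t * x\<^sup>2)) * iexp (\<xi> * x)" for x
    using c by (simp add: std_normal_density_def scaleR_conv_of_real u_def power_mult_distrib field_simps)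
  moreover have "complex_of_real (sqrt (2 * pi)) * (complex_of_real (exp (- (u\<^sup>2) / 2)) /\<^sub>R \<bar>c\<bar>)
      = complex_of_real (sqrt (pi / t) * exp (- \<xi>\<^sup>2 / (4 * t)))"
  proof -
    have "sqrt (pi / t) = sqrt (2 * pi) / c" using assms
      by (simp add: c_def real_sqrt_divide real_sqrt_mult)
    moreover have "u\<^sup>2 / 2 = \<xi>\<^sup>2 / (4 * t)" using c by (simp add: u_def power_divide)
    ultimately have "sqrt (2 * pi) * (exp (- (u\<^sup>2) / 2) / c) = sqrt (pi / t) * exp (- \<xi>\<^sup>2 / (4 * t))"
      by simp
    moreover have "complex_of_real (sqrt (2 * pi)) * (complex_of_real (exp (- (u\<^sup>2) / 2)) /\<^sub>R \<bar>c\<bar>)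
        = complex_of_real (sqrt (2 * pi) * (exp (- (u\<^sup>2) / 2) / c))"
      using c(1) by (simp add: scaleR_conv_of_real field_simps)
    ultimately show ?thesis by (simp only:)
  qed
  ultimately show ?thesis by simp
qed

text \<open>Both the Gaussian and the exponential of an inner product factor over the coordinates,
  and \<open>lborel\<close> is the image of the product of the one-dimensional Lebesgue
  measures.\<close>

lemma gaussian_fourier:
  fixes \<xi> :: "'a::euclidean_space"
  assumes "t > 0"
  shows "has_bochner_integral lborel (\<lambda>x. of_real (exp (- t * (norm x)\<^sup>2)) * iexp (\<xi> \<bullet> x))
           (complex_of_real ((pi / t) powr (DIM('a) / 2) * exp (- (norm \<xi>)\<^sup>2 / (4 * t))))"
proof -
  interpret product_sigma_finite "\<lambda>_::'a. lborel :: real measure" ..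
  define f where "f b x = complex_of_real (exp (- t * x\<^sup>2)) * iexp ((\<xi> \<bullet> b) * x)" for b :: 'a and x :: real
  have f: "has_bochner_integral lborel (f b) (complex_of_real (sqrt (pi / t) * exp (- (\<xi> \<bullet> b)\<^sup>2 / (4 * t))))" for b
    unfolding f_def by (rule gaussian_fourier_real[OF assms])
  have P: "has_bochner_integral (Pi\<^sub>M Basis (\<lambda>_::'a. lborel :: real measure)) (\<lambda>x. \<Prod>b\<in>Basis. f b (x b))
     (\<Prod>b\<in>Basis. complex_of_real (sqrt (pi / t) * exp (- (\<xi> \<bullet> b)\<^sup>2 / (4 * t))))"
    unfolding has_bochner_integral_iff
    using f by (auto simp: has_bochner_integral_iff intro!: product_integrable_prod)
       (subst product_integral_prod, auto simp: has_bochner_integral_iff)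
  have eq: "(\<Prod>b\<in>Basis. f b (y \<bullet> b)) = of_real (exp (- t * (norm y)\<^sup>2)) * iexp (\<xi> \<bullet> y)" for y :: 'a
  proof -
    have "(norm y)\<^sup>2 = (\<Sum>b\<in>Basis. (y \<bullet> b)\<^sup>2)"
      unfolding power2_norm_eq_inner by (subst euclidean_inner) (simp add: power2_eq_square)
    moreover have "\<xi> \<bullet> y = (\<Sum>b\<in>Basis. (\<xi> \<bullet> b) * (y \<bullet> b))"
      by (rule euclidean_inner)
    ultimately show ?thesis
      by (simp add: f_def prod.distrib exp_sum sum_distrib_left)
  qed
  have val: "(\<Prod>b\<in>Basis. complex_of_real (sqrt (pi / t) * exp (- (\<xi> \<bullet> b)\<^sup>2 / (4 * t))))
     = complex_of_real ((pi / t) powr (DIM('a) / 2) * exp (- (norm \<xi>)\<^sup>2 / (4 * t)))"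
  proof -
    have "(norm \<xi>)\<^sup>2 = (\<Sum>b\<in>Basis. (\<xi> \<bullet> b)\<^sup>2)"
      unfolding power2_norm_eq_inner by (subst euclidean_inner) (simp add: power2_eq_square)
    moreover have "sqrt (pi / t) ^ DIM('a) = (pi / t) powr (DIM('a) / 2)"
      using assms by (simp add: powr_half_sqrt[symmetric] powr_realpow[symmetric] powr_powr)
    ultimately have "(\<Prod>b\<in>Basis. sqrt (pi / t) * exp (- (\<xi> \<bullet> b)\<^sup>2 / (4 * t)))
        = (pi / t) powr (DIM('a) / 2) * exp (- (norm \<xi>)\<^sup>2 / (4 * t))"
      by (simp add: prod.distrib exp_sum[symmetric] sum_negf sum_divide_distrib)
    thus ?thesis unfolding of_real_prod[symmetric] by simp
  qed
  show ?thesis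
    unfolding val[symmetric] eq[symmetric] lborel_eq[where 'a = 'a]
  proof (rule has_bochner_integral_distr)
    show "has_bochner_integral (Pi\<^sub>M Basis (\<lambda>_::'a. lborel :: real measure))
       (\<lambda>x. \<Prod>b\<in>Basis. f b ((\<Sum>b\<in>Basis. x b *\<^sub>R b) \<bullet> b))
       (\<Prod>b\<in>Basis. complex_of_real (sqrt (pi / t) * exp (- (\<xi> \<bullet> b)\<^sup>2 / (4 * t))))"
      using P by (simp cong: prod.cong)
  qed (simp_all add: f_def)
qed

section \<open>The stable Levy measure as a Gaussian mixture\<close>

lemma has_vector_derivative_iff_quotient:
  fixes f :: "real \<Rightarrow> 'b::real_normed_vector"
  shows "(f has_vector_derivative D) (at s) \<longleftrightarrow> ((\<lambda>t. (f t - f s) /\<^sub>R (t - s)) \<longlongrightarrow> D) (at s)"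
proof -
  have "norm (f t - f s - (t - s) *\<^sub>R D) / norm (t - s) = norm ((f t - f s) /\<^sub>R (t - s) - D)" if "t \<noteq> s" for t
  proof -
    have "(f t - f s) /\<^sub>R (t - s) - D = (f t - f s - (t - s) *\<^sub>R D) /\<^sub>R (t - s)"
      using that by (simp add: scaleR_diff_right)
    thus ?thesis by (simp add: divide_inverse mult.commute)
  qed
  hence "((\<lambda>t. norm (f t - f s - (t - s) *\<^sub>R D) / norm (t - s)) \<longlongrightarrow> 0) (at s)
      \<longleftrightarrow> ((\<lambda>t. norm ((f t - f s) /\<^sub>R (t - s) - D)) \<longlongrightarrow> 0) (at s)"
    by (intro Lim_cong_within) auto
  thus ?thesis
    by (simp add: has_vector_derivative_def has_derivative_iff_norm bounded_linear_scaleR_left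
        tendsto_norm_zero_iff LIM_zero_iff)
qed

text \<open>Differentiation under the integral by dominated convergence of difference quotients:
  |exp (i a) - 1| <= |a| bounds each quotient by |w y|. It serves twice, for a Gaussian weight on
  Lebesgue measure and for the weight 1 on the law of X.\<close>

lemma has_vector_derivative_fourier_integral:
  fixes w y :: "'a \<Rightarrow> real"
  assumes w: "integrable M w" and wy: "integrable M (\<lambda>x. w x * y x)"
    and [measurable]: "y \<in> borel_measurable M"
  shows "((\<lambda>s. CLINT x|M. w x *\<^sub>R iexp (s * y x)) has_vector_derivative
            (CLINT x|M. (w x * y x) *\<^sub>R (\<i> * iexp (s * y x)))) (at s)"
proof -
  have [measurable]: "w \<in> borel_measurable M" using w by auto
  define F where "F s = (CLINT x|M. w x *\<^sub>R iexp (s * y x))" for s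
  define D where "D = (CLINT x|M. (w x * y x) *\<^sub>R (\<i> * iexp (s * y x)))"
  have int: "integrable M (\<lambda>x. w x *\<^sub>R iexp (s * y x))" for s
    by (rule Bochner_Integration.integrable_bound[OF w]) auto
  have lim: "(\<lambda>i. (F (X i) - F s) /\<^sub>R (X i - s)) \<longlonglongrightarrow> D"
    if X: "\<And>i. X i \<noteq> s" "X \<longlonglongrightarrow> s" for X :: "nat \<Rightarrow> real"
  proof -
    have "(F (X i) - F s) /\<^sub>R (X i - s)
        = (CLINT x|M. w x *\<^sub>R ((iexp (X i * y x) - iexp (s * y x)) /\<^sub>R (X i - s)))" for i
    proof -
      have "F (X i) - F s = (CLINT x|M. w x *\<^sub>R (iexp (X i * y x) - iexp (s * y x)))"
        unfolding F_def using int by (simp add: scaleR_diff_right)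
      hence "(F (X i) - F s) /\<^sub>R (X i - s)
          = (CLINT x|M. inverse (X i - s) *\<^sub>R (w x *\<^sub>R (iexp (X i * y x) - iexp (s * y x))))"
        by (simp only: integral_scaleR_right)
      also have "\<dots> = (CLINT x|M. w x *\<^sub>R ((iexp (X i * y x) - iexp (s * y x)) /\<^sub>R (X i - s)))"
        by (intro Bochner_Integration.integral_cong refl) (simp add: mult.commute)
      finally show ?thesis .
    qed
    moreover have "(\<lambda>i. CLINT x|M. w x *\<^sub>R ((iexp (X i * y x) - iexp (s * y x)) /\<^sub>R (X i - s))) \<longlonglongrightarrow> D"
      unfolding D_def
    proof (rule integral_dominated_convergence)
      show "integrable M (\<lambda>x. norm (w x * y x))" using wy by (rule integrable_norm)
      show "AE x in M. (\<lambda>i. w x *\<^sub>R ((iexp (X i * y x) - iexp (s * y x)) /\<^sub>R (X i - s)))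
              \<longlonglongrightarrow> (w x * y x) *\<^sub>R (\<i> * iexp (s * y x))"
      proof (rule AE_I2)
        fix x
        have "((\<lambda>s. iexp (s * y x)) has_vector_derivative y x *\<^sub>R (\<i> * iexp (s * y x))) (at s)"
        proof -
          have "((\<lambda>s. s * y x) has_vector_derivative y x) (at s)"
            by (auto intro!: derivative_eq_intros)
          from vector_diff_chain_at[OF this has_vector_derivative_iexp]
          show ?thesis by (simp add: o_def)
        qed
        hence "((\<lambda>t. (iexp (t * y x) - iexp (s * y x)) /\<^sub>R (t - s)) \<longlongrightarrow> y x *\<^sub>R (\<i> * iexp (s * y x))) (at s)"
          by (simp add: has_vector_derivative_iff_quotient)
        hence "(\<lambda>i. (iexp (X i * y x) - iexp (s * y x)) /\<^sub>R (X i - s)) \<longlonglongrightarrow> y x *\<^sub>R (\<i> * iexp (s * y x))"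
          using X by (auto simp: tendsto_at_iff_sequentially o_def)
        from tendsto_scaleR[OF tendsto_const[of "w x"] this]
        show "(\<lambda>i. w x *\<^sub>R ((iexp (X i * y x) - iexp (s * y x)) /\<^sub>R (X i - s)))
              \<longlonglongrightarrow> (w x * y x) *\<^sub>R (\<i> * iexp (s * y x))" by simp
      qed
      fix i
      show "AE x in M. norm (w x *\<^sub>R ((iexp (X i * y x) - iexp (s * y x)) /\<^sub>R (X i - s))) \<le> norm (w x * y x)"
      proof (rule AE_I2)
        fix x
        have "iexp (X i * y x) - iexp (s * y x) = iexp (s * y x) * (iexp ((X i - s) * y x) - 1)"
          by (simp add: algebra_simps exp_add[symmetric])
        hence "norm (iexp (X i * y x) - iexp (s * y x)) = norm (iexp ((X i - s) * y x) - 1)"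
          by (simp add: norm_mult)
        also have "\<dots> \<le> \<bar>(X i - s) * y x\<bar>" using iexp_approx1[of "(X i - s) * y x" 0] by simp
        finally have "norm (iexp (X i * y x) - iexp (s * y x)) / \<bar>X i - s\<bar> \<le> \<bar>y x\<bar>"
          using X(1)[of i] by (simp add: divide_le_eq abs_mult mult.commute)
        hence "\<bar>w x\<bar> * (norm (iexp (X i * y x) - iexp (s * y x)) / \<bar>X i - s\<bar>) \<le> \<bar>w x\<bar> * \<bar>y x\<bar>"
          by (intro mult_left_mono) auto
        thus "norm (w x *\<^sub>R ((iexp (X i * y x) - iexp (s * y x)) /\<^sub>R (X i - s))) \<le> norm (w x * y x)"
          by (simp add: abs_mult divide_inverse mult_ac)
      qed
    qed measurable
    ultimately show ?thesis by simp
  qed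
  have "((\<lambda>t. (F t - F s) /\<^sub>R (t - s)) \<longlongrightarrow> D) (at s)"
    using lim by (auto simp: tendsto_at_iff_sequentially o_def)
  hence "(F has_vector_derivative D) (at s)"
    by (simp add: has_vector_derivative_iff_quotient)
  thus ?thesis by (simp add: F_def[abs_def] D_def)
qed

lemma gaussian_integral:
  assumes "t > 0"
  shows "has_bochner_integral lborel (\<lambda>u::'a::euclidean_space. exp (- t * (norm u)\<^sup>2)) ((pi / t) powr (DIM('a) / 2))"
  using has_bochner_integral_Re[OF gaussian_fourier[OF assms, of "0::'a"]] by simp

lemma integrable_gaussian:
  assumes "t > 0"
  shows "integrable lborel (\<lambda>u::'a::euclidean_space. exp (- t * (norm u)\<^sup>2))"
  using gaussian_integral[OF assms] by (rule has_bochner_integral_iff[THEN iffD1, THEN conjunct1])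

text \<open>Half of the exponent is spent on the extra power: with a = sqrt t * x one has a <= 1 +
  a^2 / 2 <= exp (a^2 / 2). A Gaussian of rate t / 2 is left over.\<close>

lemma gaussian_moment_bound_1:
  fixes t x :: real
  assumes "t > 0" "x \<ge> 0"
  shows "x * exp (- t * x\<^sup>2) \<le> exp (- (t / 2) * x\<^sup>2) / sqrt t"
proof -
  have "sqrt t * x \<le> 1 + (sqrt t * x)\<^sup>2 / 2"
    using sum_squares_bound[of 1 "sqrt t * x"] by simp
  also have "\<dots> = 1 + t / 2 * x\<^sup>2" using assms by (simp add: power_mult_distrib)
  also have "\<dots> \<le> exp (t / 2 * x\<^sup>2)" by (rule exp_ge_add_one_self)
  finally have "sqrt t * x * exp (- t * x\<^sup>2) \<le> exp (t / 2 * x\<^sup>2) * exp (- t * x\<^sup>2)"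
    by (intro mult_right_mono) auto
  also have "\<dots> = exp (- (t / 2) * x\<^sup>2)" by (simp add: exp_add[symmetric])
  finally show ?thesis using assms by (simp add: field_simps)
qed

lemma gaussian_moment_bound_2:
  fixes t x :: real
  assumes "t > 0"
  shows "x\<^sup>2 * exp (- t * x\<^sup>2) \<le> 2 / t * exp (- (t / 2) * x\<^sup>2)"
proof -
  have "t / 2 * x\<^sup>2 \<le> exp (t / 2 * x\<^sup>2)" using exp_ge_add_one_self[of "t / 2 * x\<^sup>2"] by linarith
  hence "t / 2 * x\<^sup>2 * exp (- t * x\<^sup>2) \<le> exp (t / 2 * x\<^sup>2) * exp (- t * x\<^sup>2)"
    by (intro mult_right_mono) auto
  also have "\<dots> = exp (- (t / 2) * x\<^sup>2)" by (simp add: exp_add[symmetric])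
  finally show ?thesis using assms by (simp add: field_simps)
qed

text \<open>The Gaussian transform along the ray s \<xi> is differentiated at s = 1. On the integral
  side the derivative has real part minus the integral sought; on the explicit side it is
  elementary.\<close>

lemma gaussian_x_sin_integral:
  fixes \<xi> :: "'a::euclidean_space"
  assumes "t > 0"
  shows "(LINT u|lborel. exp (- t * (norm u)\<^sup>2) * ((\<xi> \<bullet> u) * sin (\<xi> \<bullet> u)))
     = (pi / t) powr (DIM('a) / 2) * ((norm \<xi>)\<^sup>2 / (2 * t)) * exp (- (norm \<xi>)\<^sup>2 / (4 * t))"
proof -
  define C where "C = (pi / t) powr (DIM('a) / 2)"
  define w where "w u = exp (- t * (norm u)\<^sup>2)" for u :: 'a
  have w: "integrable lborel w"
    unfolding w_def[abs_def] using integrable_gaussian[OF assms] .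
  have wy: "integrable lborel (\<lambda>u. w u * (\<xi> \<bullet> u))"
  proof (rule Bochner_Integration.integrable_bound)
    show "integrable lborel (\<lambda>u::'a. norm \<xi> / sqrt t * exp (- (t / 2) * (norm u)\<^sup>2))"
      using assms by (intro integrable_mult_right integrable_gaussian) auto
    show "AE u in lborel. norm (w u * (\<xi> \<bullet> u)) \<le> norm (norm \<xi> / sqrt t * exp (- (t / 2) * (norm u)\<^sup>2))"
    proof (rule AE_I2)
      fix u :: 'a
      have "norm (w u * (\<xi> \<bullet> u)) \<le> w u * (norm \<xi> * norm u)"
        by (simp add: w_def abs_mult Cauchy_Schwarz_ineq2)
      also have "\<dots> = norm \<xi> * (norm u * exp (- t * (norm u)\<^sup>2))" by (simp add: w_def)
      also have "\<dots> \<le> norm \<xi> * (exp (- (t / 2) * (norm u)\<^sup>2) / sqrt t)"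
        using gaussian_moment_bound_1[OF assms, of "norm u"] by (intro mult_left_mono) auto
      finally show "norm (w u * (\<xi> \<bullet> u)) \<le> norm (norm \<xi> / sqrt t * exp (- (t / 2) * (norm u)\<^sup>2))"
        using assms by simp
    qed
  qed (simp add: w_def[abs_def])
  have F: "(CLINT u|lborel. w u *\<^sub>R iexp (s * (\<xi> \<bullet> u))) = complex_of_real (C * exp (- (s\<^sup>2 * ((norm \<xi>)\<^sup>2 / (4 * t)))))" for s
    using gaussian_fourier[OF assms, of "s *\<^sub>R \<xi>"]
    by (simp add: has_bochner_integral_iff scaleR_conv_of_real w_def C_def power_mult_distrib)
  have "((\<lambda>s. CLINT u|lborel. w u *\<^sub>R iexp (s * (\<xi> \<bullet> u))) has_vector_derivative
      (CLINT u|lborel. (w u * (\<xi> \<bullet> u)) *\<^sub>R (\<i> * iexp (1 * (\<xi> \<bullet> u))))) (at 1)"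
    by (rule has_vector_derivative_fourier_integral[OF w wy]) simp
  moreover have "((\<lambda>s. complex_of_real (C * exp (- (s\<^sup>2 * ((norm \<xi>)\<^sup>2 / (4 * t)))))) has_vector_derivative
      complex_of_real (- (C * ((norm \<xi>)\<^sup>2 / (2 * t)) * exp (- (norm \<xi>)\<^sup>2 / (4 * t))))) (at 1)"
    using assms by (intro has_vector_derivative_of_real)
       (auto intro!: derivative_eq_intros simp: has_real_derivative_iff_has_vector_derivative[symmetric])
  ultimately have eq: "(CLINT u|lborel. (w u * (\<xi> \<bullet> u)) *\<^sub>R (\<i> * iexp (\<xi> \<bullet> u)))
      = complex_of_real (- (C * ((norm \<xi>)\<^sup>2 / (2 * t)) * exp (- (norm \<xi>)\<^sup>2 / (4 * t))))"
    unfolding F by (auto dest: vector_derivative_unique_at)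
  have int: "integrable lborel (\<lambda>u. (w u * (\<xi> \<bullet> u)) *\<^sub>R (\<i> * iexp (\<xi> \<bullet> u)))"
    by (rule Bochner_Integration.integrable_bound[OF wy]) (auto simp: w_def norm_mult)
  have "(LINT u|lborel. Re ((w u * (\<xi> \<bullet> u)) *\<^sub>R (\<i> * iexp (\<xi> \<bullet> u))))
      = - (C * ((norm \<xi>)\<^sup>2 / (2 * t)) * exp (- (norm \<xi>)\<^sup>2 / (4 * t)))"
    by (subst integral_Re[OF int]) (simp only: eq Re_complex_of_real)
  moreover have "Re ((w u * (\<xi> \<bullet> u)) *\<^sub>R (\<i> * iexp (\<xi> \<bullet> u))) = - (w u * ((\<xi> \<bullet> u) * sin (\<xi> \<bullet> u)))" for u
    by (simp add: Im_exp)
  ultimately have "(LINT u|lborel. - (w u * ((\<xi> \<bullet> u) * sin (\<xi> \<bullet> u))))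
      = - (C * ((norm \<xi>)\<^sup>2 / (2 * t)) * exp (- (norm \<xi>)\<^sup>2 / (4 * t)))"
    by (simp only:)
  thus ?thesis by (simp add: w_def C_def)
qed

section \<open>Levy integrals as mixtures of Gaussian integrals\<close>

lemma stable_const_pos:
  fixes \<alpha> :: real
  assumes "1 < \<alpha>" "\<alpha> < 2"
  shows "stable_const \<alpha> d > 0"
proof -
  have cos: "cos (\<alpha> * pi / 2) < 0"
    using assms by (intro cos_lt_zero_pi) (auto simp: field_simps)
  have g: "Gamma ((\<alpha> + real d) / 2) > 0" "Gamma ((\<alpha> + 1) / 2) > 0" "Gamma (2 - \<alpha>) > 0"
    using assms by (auto intro!: Gamma_real_pos)
  have "- \<alpha> * (\<alpha> - 1) * Gamma ((\<alpha> + real d) / 2) < 0"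
    using assms g by (intro mult_neg_pos) auto
  moreover have "4 * cos (\<alpha> * pi / 2) * Gamma ((\<alpha> + 1) / 2) * pi powr ((real d - 1) / 2) * Gamma (2 - \<alpha>) < 0"
    using cos g by (simp add: mult_less_0_iff zero_less_mult_iff)
  ultimately show ?thesis unfolding stable_const_def by (rule divide_neg_neg)
qed

text \<open>This is the Gamma integral with rate |u|^2 and exponent p, half of d + \<alpha>. The
  origin has to be excluded: there the mixture diverges, while the density takes its default value
  0.\<close>

lemma stable_density_subordination:
  fixes u :: "real ^ 'd" and \<alpha> :: real
  assumes "1 < \<alpha>" "\<alpha> < 2" "u \<noteq> 0"
  defines "p \<equiv> (\<alpha> + CARD('d)) / 2"
  shows "(\<integral>\<^sup>+t\<in>{0<..}. ennreal (stable_const \<alpha> CARD('d) / Gamma p * t powr (p - 1) * exp (- t * (norm u)\<^sup>2)) \<partial>lborel)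
     = ennreal (stable_const \<alpha> CARD('d) / norm u powr (CARD('d) + \<alpha>))"
proof -
  define \<kappa> where "\<kappa> = stable_const \<alpha> CARD('d) / Gamma p"
  have p: "p > 0" using assms by (simp add: p_def add_pos_nonneg)
  have G: "Gamma p > 0" using p by (rule Gamma_real_pos)
  have \<kappa>: "\<kappa> > 0" using G stable_const_pos[OF assms(1,2)] by (simp add: \<kappa>_def)
  have "(\<integral>\<^sup>+t\<in>{0<..}. ennreal (\<kappa> * t powr (p - 1) * exp (- t * (norm u)\<^sup>2)) \<partial>lborel)
     = (\<integral>\<^sup>+t. ennreal \<kappa> * (ennreal (t powr (p - 1) * exp (- (norm u)\<^sup>2 * t)) * indicator {0<..} t) \<partial>lborel)"
    using \<kappa> by (intro nn_integral_cong) (auto simp: ennreal_mult' mult_ac split: split_indicator)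
  also have "\<dots> = ennreal \<kappa> * ennreal (Gamma p * ((norm u)\<^sup>2) powr (- p))"
    using gamma_nn_integral[OF p, of "(norm u)\<^sup>2"] assms(3) by (subst nn_integral_cmult) auto
  also have "\<dots> = ennreal (stable_const \<alpha> CARD('d) * ((norm u)\<^sup>2) powr (- p))"
    using \<kappa> G by (subst ennreal_mult'[symmetric]) (auto simp: \<kappa>_def)
  also have "((norm u)\<^sup>2) powr (- p) = 1 / norm u powr (CARD('d) + \<alpha>)"
  proof -
    have "((norm u)\<^sup>2) powr (- p) = norm u powr (2 * - p)"
    proof -
      have "(norm u)\<^sup>2 = norm u powr 2" by simp
      thus ?thesis by (simp only: powr_powr)
    qed
    also have "2 * - p = - (CARD('d) + \<alpha>)" by (simp add: p_def field_simps)
    finally show ?thesis by (simp only: powr_minus_divide)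
  qed
  finally show ?thesis by (simp add: \<kappa>_def)
qed

lemma stable_levy_nn_integral:
  fixes f :: "real ^ 'd \<Rightarrow> ennreal" and \<alpha> :: real
  assumes \<alpha>: "1 < \<alpha>" "\<alpha> < 2" and [measurable]: "f \<in> borel_measurable borel"
  defines "p \<equiv> (\<alpha> + CARD('d)) / 2"
  shows "(\<integral>\<^sup>+u. f u \<partial>stable_levy \<alpha>) = (\<integral>\<^sup>+t\<in>{0<..}. (\<integral>\<^sup>+u. ennreal (stable_const \<alpha> CARD('d) / Gamma p * t powr (p - 1) * exp (- t * (norm u)\<^sup>2)) * f u \<partial>lborel) \<partial>lborel)"
proof -
  define K where "K t u = ennreal (stable_const \<alpha> CARD('d) / Gamma p * t powr (p - 1) * exp (- t * (norm u)\<^sup>2))"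
    for t :: real and u :: "real ^ 'd"
  have [measurable]: "case_prod K \<in> borel_measurable (borel \<Otimes>\<^sub>M borel)"
    unfolding K_def[abs_def] by measurable
  have "(\<integral>\<^sup>+u. f u \<partial>stable_levy \<alpha>) = (\<integral>\<^sup>+u. ennreal (stable_const \<alpha> CARD('d) / norm u powr (CARD('d) + \<alpha>)) * f u \<partial>lborel)"
    unfolding stable_levy_def by (subst nn_integral_density) auto
  also have "\<dots> = (\<integral>\<^sup>+u. (\<integral>\<^sup>+t. K t u * f u * indicator {0<..} t \<partial>lborel) \<partial>lborel)"
  proof (rule nn_integral_cong_AE)
    show "AE u in lborel. ennreal (stable_const \<alpha> CARD('d) / norm u powr (CARD('d) + \<alpha>)) * f u
        = (\<integral>\<^sup>+t. K t u * f u * indicator {0<..} t \<partial>lborel)"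
      using AE_lborel_singleton[of 0]
    proof eventually_elim
      case (elim u)
      have "(\<integral>\<^sup>+t. K t u * f u * indicator {0<..} t \<partial>lborel) = (\<integral>\<^sup>+t. K t u * indicator {0<..} t * f u \<partial>lborel)"
        by (simp add: mult_ac)
      also have "\<dots> = (\<integral>\<^sup>+t. K t u * indicator {0<..} t \<partial>lborel) * f u"
        by (subst nn_integral_multc) auto
      also have "(\<integral>\<^sup>+t. K t u * indicator {0<..} t \<partial>lborel) = ennreal (stable_const \<alpha> CARD('d) / norm u powr (CARD('d) + \<alpha>))"
        unfolding K_def p_def by (rule stable_density_subordination[OF \<alpha> elim])
      finally show ?case by simp
    qed
  qed
  also have "\<dots> = (\<integral>\<^sup>+t. (\<integral>\<^sup>+u. K t u * f u * indicator {0<..} t \<partial>lborel) \<partial>lborel)"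
    using lborel_pair.Fubini[of "\<lambda>(t, u). K t u * f u * indicator {0<..} t"] by simp
  also have "\<dots> = (\<integral>\<^sup>+t. (\<integral>\<^sup>+u. K t u * f u \<partial>lborel) * indicator {0<..} t \<partial>lborel)"
    by (intro nn_integral_cong nn_integral_multc) measurable
  finally show ?thesis unfolding K_def .
qed

lemma stable_levy_integral:
  fixes f :: "real ^ 'd \<Rightarrow> real" and \<alpha> :: real
  assumes \<alpha>: "1 < \<alpha>" "\<alpha> < 2" and f: "integrable (stable_levy \<alpha>) f"
  defines "p \<equiv> (\<alpha> + CARD('d)) / 2"
  shows "(LINT u|stable_levy \<alpha>. f u) = (LINT t|lborel. indicator {0<..} t * (stable_const \<alpha> CARD('d) / Gamma p * t powr (p - 1) * (LINT u|lborel. exp (- t * (norm u)\<^sup>2) * f u)))"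
proof -
  define \<kappa> where "\<kappa> = stable_const \<alpha> CARD('d) / Gamma p"
  have p: "p > 0" using \<alpha> by (simp add: p_def add_pos_nonneg)
  have G: "Gamma p > 0" using p by (rule Gamma_real_pos)
  have \<kappa>: "\<kappa> > 0" using G stable_const_pos[OF \<alpha>] by (simp add: \<kappa>_def)
  have [measurable]: "f \<in> borel_measurable borel"
    using f by (auto simp: stable_levy_def dest: borel_measurable_integrable)
  define K where "K t u = indicator {0<..} t * (\<kappa> * t powr (p - 1) * exp (- t * (norm u)\<^sup>2))"
    for t :: real and u :: "real ^ 'd"
  have K0: "K t u \<ge> 0" for t u using \<kappa> by (simp add: K_def)
  have [measurable]: "case_prod K \<in> borel_measurable (borel \<Otimes>\<^sub>M borel)"
    unfolding K_def[abs_def] by measurable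
  \<comment> \<open>Absolute integrability on the product comes from the nonnegative mixture formula
    applied to |f|; this licenses the exchange of the two integrals.\<close>
  have "integrable (lborel \<Otimes>\<^sub>M lborel) (\<lambda>(t, u). K t u * f u)"
  proof (rule integrableI_bounded)
    have "(\<integral>\<^sup>+x. ennreal (norm (case x of (t, u) \<Rightarrow> K t u * f u)) \<partial>(lborel \<Otimes>\<^sub>M lborel))
        = (\<integral>\<^sup>+t. (\<integral>\<^sup>+u. ennreal (norm (K t u * f u)) \<partial>lborel) \<partial>lborel)"
      by (subst lborel.nn_integral_fst[symmetric]) auto
    also have "\<dots> = (\<integral>\<^sup>+t\<in>{0<..}. (\<integral>\<^sup>+u. ennreal (\<kappa> * t powr (p - 1) * exp (- t * (norm u)\<^sup>2)) * ennreal (norm (f u)) \<partial>lborel) \<partial>lborel)"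
      using \<kappa> by (intro nn_integral_cong) (auto simp: K_def ennreal_mult' abs_mult split: split_indicator)
    also have "\<dots> = (\<integral>\<^sup>+u. ennreal (norm (f u)) \<partial>stable_levy \<alpha>)"
      unfolding \<kappa>_def p_def by (rule stable_levy_nn_integral[OF \<alpha>, symmetric]) simp
    also have "\<dots> < \<infinity>" using f by (simp add: integrable_iff_bounded)
    finally show "(\<integral>\<^sup>+x. ennreal (norm (case x of (t, u) \<Rightarrow> K t u * f u)) \<partial>(lborel \<Otimes>\<^sub>M lborel)) < \<infinity>" .
  qed measurable
  from lborel_pair.Fubini_integral[OF this]
  have swap: "(LINT u|lborel. LINT t|lborel. K t u * f u) = (LINT t|lborel. LINT u|lborel. K t u * f u)"
    by simp
  have "(LINT u|stable_levy \<alpha>. f u) = (LINT u|lborel. (stable_const \<alpha> CARD('d) / norm u powr (CARD('d) + \<alpha>)) * f u)"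
    unfolding stable_levy_def using stable_const_pos[OF \<alpha>, of "CARD('d)"]
    by (subst integral_density) (auto intro!: AE_I2 divide_nonneg_nonneg)
  also have "\<dots> = (LINT u|lborel. LINT t|lborel. K t u * f u)"
  proof (rule integral_cong_AE)
    show "AE u in lborel. (stable_const \<alpha> CARD('d) / norm u powr (CARD('d) + \<alpha>)) * f u = (LINT t|lborel. K t u * f u)"
      using AE_lborel_singleton[of 0]
    proof eventually_elim
      case (elim u)
      have "(\<integral>\<^sup>+t. ennreal (K t u) \<partial>lborel) = ennreal (stable_const \<alpha> CARD('d) / norm u powr (CARD('d) + \<alpha>))"
        unfolding stable_density_subordination[OF \<alpha> elim, symmetric]
        by (intro nn_integral_cong) (auto simp: K_def \<kappa>_def p_def split: split_indicator)
      hence "has_bochner_integral lborel (\<lambda>t. K t u) (stable_const \<alpha> CARD('d) / norm u powr (CARD('d) + \<alpha>))"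
        using K0 stable_const_pos[OF \<alpha>, of "CARD('d)"]
        by (intro has_bochner_integral_nn_integral) (auto intro!: divide_nonneg_nonneg)
      thus ?case by (simp add: has_bochner_integral_iff)
    qed
  qed measurable
  also have "\<dots> = (LINT t|lborel. LINT u|lborel. K t u * f u)" by (rule swap)
  also have "\<dots> = (LINT t|lborel. indicator {0<..} t * (\<kappa> * t powr (p - 1) * (LINT u|lborel. exp (- t * (norm u)\<^sup>2) * f u)))"
    by (intro Bochner_Integration.integral_cong refl) (simp add: K_def mult.assoc)
  finally show ?thesis unfolding \<kappa>_def .
qed

text \<open>After the Gaussian integral in u, the weight in t is t^(\<alpha>/2 - 1) times min (1 /
  sqrt t) (2 / t), the two factors of the moment bounds. Near 0 it is of order t^((\<alpha> - 3)/2),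
  integrable because \<alpha> > 1; at infinity it is of order t^(\<alpha>/2 - 2), integrable because
  \<alpha> < 2. Small t corresponds to large jumps.\<close>

lemma stable_levy_integrable_min:
  fixes \<alpha> :: real
  assumes \<alpha>: "1 < \<alpha>" "\<alpha> < 2"
  shows "integrable (stable_levy \<alpha>) (\<lambda>u::real ^ 'd. min (norm u) ((norm u)\<^sup>2))"
proof (rule integrableI_bounded)
  define p where "p = (\<alpha> + CARD('d)) / 2"
  define \<kappa> where "\<kappa> = stable_const \<alpha> CARD('d) / Gamma p"
  have p: "p > 0" using \<alpha> by (simp add: p_def add_pos_nonneg)
  have G: "Gamma p > 0" using p by (rule Gamma_real_pos)
  have \<kappa>: "\<kappa> > 0" using G stable_const_pos[OF \<alpha>] by (simp add: \<kappa>_def)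
  define n where "n = real CARD('d) / 2"
  define C where "C = \<kappa> * ((2 * pi) powr n * (2 * exp 1))"
  have C: "C > 0" using \<kappa> by (simp add: C_def)
  \<comment> \<open>Each summand carries one end of the half-line and has a closed-form integral, by
    the Gamma and the inverse Gamma lemma. The factor \<open>exp 1\<close> in \<open>C\<close>
    compensates exp (- t) for t <= 1 and exp (- 1 / t) for t > 1.\<close>
  define H where "H t = t powr ((\<alpha> - 1) / 2 - 1) * exp (- 1 * t) + t powr (- (1 - \<alpha> / 2) - 1) * exp (- 1 / t)" for t :: real
  have inner: "(\<integral>\<^sup>+u. ennreal (\<kappa> * t powr (p - 1) * exp (- t * (norm u)\<^sup>2)) * ennreal (norm (min (norm u) ((norm u)\<^sup>2))) \<partial>(lborel :: (real ^ 'd) measure))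
      \<le> ennreal (C * H t)" if t: "t > 0" for t
  proof -
    define b where "b = min (1 / sqrt t) (2 / t)"
    have b: "b \<ge> 0" using t by (simp add: b_def)
    have "(\<integral>\<^sup>+u. ennreal (\<kappa> * t powr (p - 1) * exp (- t * (norm u)\<^sup>2)) * ennreal (norm (min (norm u) ((norm u)\<^sup>2))) \<partial>(lborel :: (real ^ 'd) measure))
      \<le> (\<integral>\<^sup>+u. ennreal (\<kappa> * t powr (p - 1) * b * exp (- (t / 2) * (norm u)\<^sup>2)) \<partial>(lborel :: (real ^ 'd) measure))"
    proof (rule nn_integral_mono)
      fix u :: "real ^ 'd"
      have "min (norm u) ((norm u)\<^sup>2) * exp (- t * (norm u)\<^sup>2) \<le> b * exp (- (t / 2) * (norm u)\<^sup>2)"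
        using gaussian_moment_bound_1[OF t, of "norm u"] gaussian_moment_bound_2[OF t, of "norm u"]
        by (auto simp: b_def min_mult_distrib_right)
      hence "\<kappa> * t powr (p - 1) * (min (norm u) ((norm u)\<^sup>2) * exp (- t * (norm u)\<^sup>2)) \<le> \<kappa> * t powr (p - 1) * (b * exp (- (t / 2) * (norm u)\<^sup>2))"
        using \<kappa> by (intro mult_left_mono) auto
      thus "ennreal (\<kappa> * t powr (p - 1) * exp (- t * (norm u)\<^sup>2)) * ennreal (norm (min (norm u) ((norm u)\<^sup>2)))
          \<le> ennreal (\<kappa> * t powr (p - 1) * b * exp (- (t / 2) * (norm u)\<^sup>2))"
        using \<kappa> by (subst ennreal_mult'[symmetric]) (auto intro!: ennreal_leI simp: mult_ac)
    qed
    also have "\<dots> = ennreal (\<kappa> * t powr (p - 1) * b * (pi / (t / 2)) powr (DIM(real ^ 'd) / 2))"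
      using has_bochner_integral_mult_right[OF gaussian_integral[of "t / 2", where 'a = "real ^ 'd"], of "\<kappa> * t powr (p - 1) * b"] t \<kappa> b
      by (subst nn_integral_eq_integral) (auto simp: has_bochner_integral_iff)
    also have "\<kappa> * t powr (p - 1) * b * (pi / (t / 2)) powr (DIM(real ^ 'd) / 2) = \<kappa> * (2 * pi) powr n * (t powr (\<alpha> / 2 - 1) * b)"
    proof -
      have E1: "(pi / (t / 2)) powr (DIM(real ^ 'd) / 2) = (2 * pi) powr n * t powr (- n)"
        using t by (simp add: n_def powr_divide powr_minus_divide mult.commute)
      have E2: "t powr (p - 1) * t powr (- n) = t powr (\<alpha> / 2 - 1)"
        by (simp add: powr_add[symmetric] p_def n_def add_divide_distrib)
      show ?thesis unfolding E1 E2[symmetric] by (simp only: mult_ac)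
    qed
    also have "\<dots> \<le> C * H t"
    proof -
      have "t powr (\<alpha> / 2 - 1) * b \<le> 2 * exp 1 * H t"
      proof (cases "t \<le> 1")
        case True
        have "t powr (\<alpha> / 2 - 1) * b \<le> t powr (\<alpha> / 2 - 1) * (1 / sqrt t)"
          by (intro mult_left_mono) (auto simp: b_def)
        also have "1 / sqrt t = t powr (- (1 / 2))"
          using t by (simp add: powr_minus_divide powr_half_sqrt)
        also have "t powr (\<alpha> / 2 - 1) * t powr (- (1 / 2)) = t powr ((\<alpha> - 1) / 2 - 1)"
          by (simp add: powr_add[symmetric] diff_divide_distrib)
        also have "\<dots> * 1 \<le> t powr ((\<alpha> - 1) / 2 - 1) * (exp 1 * exp (- 1 * t))"
          using True by (intro mult_left_mono) (auto simp: exp_add[symmetric])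
        also have "\<dots> = exp 1 * (t powr ((\<alpha> - 1) / 2 - 1) * exp (- 1 * t))" by simp
        also have "\<dots> \<le> exp 1 * (2 * H t)"
          by (intro mult_left_mono) (auto simp: H_def)
        finally show ?thesis by simp
      next
        case False
        have "t powr (\<alpha> / 2 - 1) * b \<le> t powr (\<alpha> / 2 - 1) * (2 / t)"
          by (intro mult_left_mono) (auto simp: b_def)
        also have "2 / t = 2 * t powr (- 1)" using t by (simp add: powr_minus_divide)
        also have "t powr (\<alpha> / 2 - 1) * (2 * t powr (- 1)) = 2 * t powr ((\<alpha> / 2 - 1) + (- 1))"
          unfolding powr_add by (simp only: mult_ac)
        also have "(\<alpha> / 2 - 1) + (- 1) = - (1 - \<alpha> / 2) - 1" by simp
        also have "2 * t powr (- (1 - \<alpha> / 2) - 1) \<le> 2 * t powr (- (1 - \<alpha> / 2) - 1) * (exp 1 * exp (- 1 / t))"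
          using False by (intro mult_le_cancel_left1[THEN iffD2]) (auto simp: exp_add[symmetric])
        also have "\<dots> = 2 * exp 1 * (t powr (- (1 - \<alpha> / 2) - 1) * exp (- 1 / t))" by simp
        also have "\<dots> \<le> 2 * exp 1 * H t"
          by (intro mult_left_mono) (auto simp: H_def)
        finally show ?thesis .
      qed
      hence "\<kappa> * (2 * pi) powr n * (t powr (\<alpha> / 2 - 1) * b) \<le> \<kappa> * (2 * pi) powr n * (2 * exp 1 * H t)"
        using \<kappa> by (intro mult_left_mono) auto
      thus ?thesis by (simp add: C_def mult_ac)
    qed
    finally show ?thesis by (auto simp: ennreal_leI)
  qed
  have "(\<integral>\<^sup>+u. ennreal (norm (min (norm u) ((norm u)\<^sup>2))) \<partial>(stable_levy \<alpha> :: (real ^ 'd) measure))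
     = (\<integral>\<^sup>+t\<in>{0<..}. (\<integral>\<^sup>+u. ennreal (\<kappa> * t powr (p - 1) * exp (- t * (norm u)\<^sup>2)) * ennreal (norm (min (norm u) ((norm u)\<^sup>2))) \<partial>(lborel :: (real ^ 'd) measure)) \<partial>lborel)"
    unfolding \<kappa>_def p_def by (rule stable_levy_nn_integral[OF \<alpha>]) simp
  also have "\<dots> \<le> (\<integral>\<^sup>+t\<in>{0<..}. ennreal (C * H t) \<partial>lborel)"
  proof (rule nn_integral_mono)
    fix t :: real
    show "(\<integral>\<^sup>+u. ennreal (\<kappa> * t powr (p - 1) * exp (- t * (norm u)\<^sup>2)) * ennreal (norm (min (norm u) ((norm u)\<^sup>2))) \<partial>(lborel :: (real ^ 'd) measure)) * indicator {0<..} t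
        \<le> ennreal (C * H t) * indicator {0<..} t"
      using inner[of t] by (cases "t > 0") auto
  qed
  also have "\<dots> = (\<integral>\<^sup>+t. ennreal C * (ennreal (t powr ((\<alpha> - 1) / 2 - 1) * exp (- 1 * t)) * indicator {0<..} t
       + ennreal (t powr (- (1 - \<alpha> / 2) - 1) * exp (- 1 / t)) * indicator {0<..} t) \<partial>lborel)"
    using C by (intro nn_integral_cong) (auto simp: H_def ennreal_mult' ennreal_plus split: split_indicator)
  also have "\<dots> = ennreal C * (ennreal (Gamma ((\<alpha> - 1) / 2) * 1 powr (- ((\<alpha> - 1) / 2))) + ennreal (Gamma (1 - \<alpha> / 2) * 1 powr (- (1 - \<alpha> / 2))))"
    using \<alpha> gamma_nn_integral[of "(\<alpha> - 1) / 2" 1] inverse_gamma_nn_integral[of "1 - \<alpha> / 2" 1]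
    by (subst nn_integral_cmult, simp, subst nn_integral_add) auto
  also have "\<dots> < \<infinity>" by (simp add: ennreal_mult_less_top)
  finally show "(\<integral>\<^sup>+u. ennreal (norm (min (norm u) ((norm u)\<^sup>2))) \<partial>(stable_levy \<alpha> :: (real ^ 'd) measure)) < \<infinity>" .
qed (simp add: stable_levy_def)

lemma
  fixes \<alpha> :: real and \<xi> :: "real ^ 'd"
  assumes \<alpha>: "1 < \<alpha>" "\<alpha> < 2"
  shows integrable_stable_levy_x_sin: "integrable (stable_levy \<alpha>) (\<lambda>u. (\<xi> \<bullet> u) * sin (\<xi> \<bullet> u))" (is ?int)
    and stable_levy_x_sin_integral: "(LINT u|stable_levy \<alpha>. (\<xi> \<bullet> u) * sin (\<xi> \<bullet> u)) = \<alpha> / 2 * norm \<xi> powr \<alpha>" (is ?eq)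
proof -
  show ?int
  proof (rule Bochner_Integration.integrable_bound)
    \<comment> \<open>Bounding the sine by 1 costs |xi| |u|, bounding it by its argument costs
      |xi|^2 |u|^2; the sum of the two constants covers both estimates at once.\<close>
    show "integrable (stable_levy \<alpha>) (\<lambda>u::real ^ 'd. (norm \<xi> + (norm \<xi>)\<^sup>2) * min (norm u) ((norm u)\<^sup>2))"
      by (intro integrable_mult_right stable_levy_integrable_min[OF \<alpha>])
    show "AE u in stable_levy \<alpha>. norm ((\<xi> \<bullet> u) * sin (\<xi> \<bullet> u)) \<le> norm ((norm \<xi> + (norm \<xi>)\<^sup>2) * min (norm u) ((norm u)\<^sup>2))"
    proof (rule AE_I2)
      fix u :: "real ^ 'd"
      have CS: "\<bar>\<xi> \<bullet> u\<bar> \<le> norm \<xi> * norm u" by (rule Cauchy_Schwarz_ineq2)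
      have "\<bar>\<xi> \<bullet> u\<bar> * \<bar>sin (\<xi> \<bullet> u)\<bar> \<le> (norm \<xi> * norm u) * 1"
        using CS by (intro mult_mono) auto
      hence 1: "\<bar>\<xi> \<bullet> u\<bar> * \<bar>sin (\<xi> \<bullet> u)\<bar> \<le> (norm \<xi> + (norm \<xi>)\<^sup>2) * norm u"
        by (simp add: ring_distribs) (smt (verit) mult_nonneg_nonneg norm_ge_zero zero_le_power2)
      have "\<bar>\<xi> \<bullet> u\<bar> * \<bar>sin (\<xi> \<bullet> u)\<bar> \<le> (norm \<xi> * norm u) * (norm \<xi> * norm u)"
        using CS abs_sin_x_le_abs_x[of "\<xi> \<bullet> u"] by (intro mult_mono) auto
      hence 2: "\<bar>\<xi> \<bullet> u\<bar> * \<bar>sin (\<xi> \<bullet> u)\<bar> \<le> (norm \<xi> + (norm \<xi>)\<^sup>2) * (norm u)\<^sup>2"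
        by (simp add: ring_distribs power2_eq_square mult_ac)
           (smt (verit) mult_nonneg_nonneg norm_ge_zero)
      show "norm ((\<xi> \<bullet> u) * sin (\<xi> \<bullet> u)) \<le> norm ((norm \<xi> + (norm \<xi>)\<^sup>2) * min (norm u) ((norm u)\<^sup>2))"
        using 1 2 by (auto simp: abs_mult min_def)
    qed
  qed (simp add: stable_levy_def)
  show ?eq
  proof (cases "\<xi> = 0")
    case True
    thus ?thesis by simp
  next
    case False
    define p where "p = (\<alpha> + CARD('d)) / 2"
    define \<kappa> where "\<kappa> = stable_const \<alpha> CARD('d) / Gamma p"
    \<comment> \<open>The Gaussian transform contributes exp (- |xi|^2 / (4 t)) = exp (- r / t). The
      powers of t, namely p - 1 from the mixture, - d / 2 from the Gaussian mass and - 1 from the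
      derivative, add up to - b - 1 for the \<open>b\<close> below.\<close>
    define r where "r = (norm \<xi>)\<^sup>2 / 4"
    have r: "r > 0" using False by (simp add: r_def)
    define b where "b = 1 - \<alpha> / 2"
    have b: "b > 0" using \<alpha> by (simp add: b_def)
    define n where "n = real CARD('d) / 2"
    have "(LINT u|stable_levy \<alpha>. (\<xi> \<bullet> u) * sin (\<xi> \<bullet> u))
      = (LINT t|lborel. indicator {0<..} t * (\<kappa> * t powr (p - 1) * (LINT u|lborel. exp (- t * (norm u)\<^sup>2) * ((\<xi> \<bullet> u) * sin (\<xi> \<bullet> u)))))"
      unfolding \<kappa>_def p_def by (rule stable_levy_integral[OF \<alpha> \<open>?int\<close>])
    also have "\<dots> = (LINT t|lborel. (\<kappa> * pi powr n * (2 * r)) * (t powr (- b - 1) * exp (- r / t) * indicator {0<..} t))"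
    proof (rule Bochner_Integration.integral_cong[OF refl])
      fix t :: real
      show "indicator {0<..} t * (\<kappa> * t powr (p - 1) * (LINT u|lborel. exp (- t * (norm u)\<^sup>2) * ((\<xi> \<bullet> u) * sin (\<xi> \<bullet> u))))
         = (\<kappa> * pi powr n * (2 * r)) * (t powr (- b - 1) * exp (- r / t) * indicator {0<..} t)"
      proof (cases "t > 0")
        case True
        have E1: "(pi / t) powr (DIM(real ^ 'd) / 2) = pi powr n * t powr (- n)"
          using True by (simp add: n_def powr_divide powr_minus_divide)
        have E2: "(norm \<xi>)\<^sup>2 / (2 * t) = 2 * r * t powr (- 1)"
          using True by (simp add: r_def powr_minus_divide)
        have E3: "- (norm \<xi>)\<^sup>2 / (4 * t) = - r / t" by (simp add: r_def)
        have "- b - 1 = (p - 1) + (- n) + (- 1)"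
          by (simp add: p_def n_def b_def add_divide_distrib)
        hence E4: "t powr (- b - 1) = t powr (p - 1) * t powr (- n) * t powr (- 1)"
          by (simp only: powr_add)
        show ?thesis
          unfolding gaussian_x_sin_integral[OF True] E1 E2 E3 E4 by (simp only: mult_ac)
      qed simp
    qed
    also have "\<dots> = (\<kappa> * pi powr n * (2 * r)) * (Gamma b * r powr (- b))"
    proof -
      have "(\<integral>\<^sup>+t. ennreal (t powr (- b - 1) * exp (- r / t) * indicator {0<..} t) \<partial>lborel) = ennreal (Gamma b * r powr (- b))"
        unfolding inverse_gamma_nn_integral[OF b r, symmetric]
        by (intro nn_integral_cong) (auto split: split_indicator)
      hence "has_bochner_integral lborel (\<lambda>t. t powr (- b - 1) * exp (- r / t) * indicator {0<..} t) (Gamma b * r powr (- b))"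
        using b by (intro has_bochner_integral_nn_integral) (auto intro!: mult_nonneg_nonneg less_imp_le[OF Gamma_real_pos])
      thus ?thesis by (simp add: has_bochner_integral_iff)
    qed
    also have "\<dots> = (\<kappa> * pi powr n * Gamma b) * (2 * r powr (1 - b))"
      using r by (simp add: powr_diff powr_minus_divide)
    also have "\<kappa> * pi powr n * Gamma b = \<alpha> * 2 powr (\<alpha> - 2)"
      using stable_const_identity[OF \<alpha>, of "CARD('d)"] by (simp add: \<kappa>_def p_def n_def b_def)
    also have "r powr (1 - b) = norm \<xi> powr \<alpha> / 2 powr \<alpha>"
    proof -
      have "r = (norm \<xi> / 2) powr 2" using False by (simp add: r_def power_divide)
      hence "r powr (1 - b) = (norm \<xi> / 2) powr \<alpha>" by (simp only: powr_powr) (simp add: b_def)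
      thus ?thesis by (simp add: powr_divide)
    qed
    also have "\<alpha> * 2 powr (\<alpha> - 2) * (2 * (norm \<xi> powr \<alpha> / 2 powr \<alpha>)) = \<alpha> / 2 * norm \<xi> powr \<alpha>"
      by (simp add: powr_diff)
    finally show ?thesis .
  qed
qed

section \<open>Uniqueness of characteristic functions\<close>

text \<open>A Gaussian is itself a Fourier transform, of a Gaussian of dual rate 1 / (4 t). By
  Fubini the smoothing of the measure therefore depends on the measure only through its
  characteristic function.\<close>

lemma integral_gaussian_eq_fourier:
  fixes \<mu> :: "'a::euclidean_space measure"
  assumes \<mu>: "finite_measure \<mu>" and sets[measurable_cong]: "sets \<mu> = sets borel" and t: "t > 0"
  shows "complex_of_real ((4 * t * pi) powr (DIM('a) / 2) * (LINT x|\<mu>. exp (- t * (norm (x - y))\<^sup>2)))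
     = (CLINT \<xi>|lborel. of_real (exp (- (1 / (4 * t)) * (norm \<xi>)\<^sup>2)) * iexp (- (\<xi> \<bullet> y)) * (CLINT x|\<mu>. iexp (\<xi> \<bullet> x)))"
proof -
  interpret finite_measure \<mu> by fact
  interpret pair_sigma_finite \<mu> "lborel :: 'a measure" ..
  define g where "g \<xi> = exp (- (1 / (4 * t)) * (norm \<xi>)\<^sup>2)" for \<xi> :: 'a
  have [measurable]: "g \<in> borel_measurable borel" unfolding g_def[abs_def] by measurable
  have "integrable (\<mu> \<Otimes>\<^sub>M lborel) (\<lambda>(x, \<xi>). of_real (g \<xi>) * iexp (\<xi> \<bullet> (x - y)))"
  proof (rule Fubini_integrable)
    have n: "norm (case (x, \<xi>) of (x, \<xi>) \<Rightarrow> of_real (g \<xi>) * iexp (\<xi> \<bullet> (x - y))) = g \<xi>" for x \<xi>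
      by (simp add: norm_mult g_def)
    show "integrable \<mu> (\<lambda>x. LINT \<xi>|lborel. norm (case (x, \<xi>) of (x, \<xi>) \<Rightarrow> of_real (g \<xi>) * iexp (\<xi> \<bullet> (x - y))))"
      unfolding n by simp
    have "integrable lborel g"
      unfolding g_def[abs_def] using t by (intro integrable_gaussian) auto
    thus "AE x in \<mu>. integrable lborel (\<lambda>\<xi>. case (x, \<xi>) of (x, \<xi>) \<Rightarrow> complex_of_real (g \<xi>) * iexp (\<xi> \<bullet> (x - y)))"
      by (auto intro!: AE_I2 elim!: Bochner_Integration.integrable_bound simp: norm_mult g_def)
  qed measurable
  from Fubini_integral[OF this]
  have "(CLINT \<xi>|lborel. CLINT x|\<mu>. of_real (g \<xi>) * iexp (\<xi> \<bullet> (x - y)))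
      = (CLINT x|\<mu>. CLINT \<xi>|lborel. of_real (g \<xi>) * iexp (\<xi> \<bullet> (x - y)))" .
  also have "\<dots> = (CLINT x|\<mu>. complex_of_real ((4 * t * pi) powr (DIM('a) / 2) * exp (- t * (norm (x - y))\<^sup>2)))"
  proof (rule Bochner_Integration.integral_cong[OF refl])
    fix x
    show "(CLINT \<xi>|lborel. of_real (g \<xi>) * iexp (\<xi> \<bullet> (x - y))) = complex_of_real ((4 * t * pi) powr (DIM('a) / 2) * exp (- t * (norm (x - y))\<^sup>2))"
      using gaussian_fourier[of "1 / (4 * t)" "x - y"] t
      by (simp add: has_bochner_integral_iff g_def inner_commute mult_ac)
  qed
  also have "\<dots> = complex_of_real ((4 * t * pi) powr (DIM('a) / 2) * (LINT x|\<mu>. exp (- t * (norm (x - y))\<^sup>2)))"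
    by (subst integral_complex_of_real) simp
  finally have *: "complex_of_real ((4 * t * pi) powr (DIM('a) / 2) * (LINT x|\<mu>. exp (- t * (norm (x - y))\<^sup>2)))
      = (CLINT \<xi>|lborel. CLINT x|\<mu>. of_real (g \<xi>) * iexp (\<xi> \<bullet> (x - y)))" ..
  have "iexp (\<xi> \<bullet> (x - y)) = iexp (- (\<xi> \<bullet> y)) * iexp (\<xi> \<bullet> x)" for \<xi> x
    by (simp add: exp_add[symmetric] inner_diff_right algebra_simps)
  thus ?thesis unfolding * by (simp add: g_def mult.assoc)
qed

text \<open>Averaging f over a Gaussian of width 1 / (k + 1) recovers f pointwise by continuity, and
  0 <= f <= 1 gives domination. The kernel is not normalised, hence the total mass as a factor in
  the limit.\<close>

lemma nn_integral_gaussian_average_tendsto: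
  fixes \<mu> :: "'a::euclidean_space measure" and f :: "'a \<Rightarrow> real"
  assumes \<mu>: "finite_measure \<mu>" and sets[measurable_cong]: "sets \<mu> = sets borel"
    and f: "continuous_on UNIV f" "\<And>x. 0 \<le> f x" "\<And>x. f x \<le> 1"
  shows "(\<lambda>k. \<integral>\<^sup>+x. (\<integral>\<^sup>+z. ennreal (f (x + z /\<^sub>R real (Suc k)) * exp (- 1 * (norm z)\<^sup>2)) \<partial>lborel) \<partial>\<mu>)
     \<longlonglongrightarrow> (\<integral>\<^sup>+x. ennreal (f x) \<partial>\<mu>) * ennreal (pi powr (DIM('a) / 2))"
proof -
  interpret finite_measure \<mu> by fact
  have [measurable]: "f \<in> borel_measurable borel" using f(1) by (rule borel_measurable_continuous_onI)
  have G: "(\<integral>\<^sup>+z. ennreal (exp (- 1 * (norm z)\<^sup>2)) \<partial>(lborel :: 'a measure)) = ennreal (pi powr (DIM('a) / 2))"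
    using gaussian_integral[of 1, where 'a = 'a]
    by (subst nn_integral_eq_integral) (auto simp: has_bochner_integral_iff)
  have "(\<lambda>k. \<integral>\<^sup>+(x, z). ennreal (f (x + z /\<^sub>R real (Suc k)) * exp (- 1 * (norm z)\<^sup>2)) \<partial>(\<mu> \<Otimes>\<^sub>M lborel))
      \<longlonglongrightarrow> (\<integral>\<^sup>+(x, z). ennreal (f x * exp (- 1 * (norm z)\<^sup>2)) \<partial>(\<mu> \<Otimes>\<^sub>M (lborel :: 'a measure)))"
  proof (rule nn_integral_dominated_convergence[where w = "\<lambda>(x::'a, z::'a). ennreal (exp (- 1 * (norm z)\<^sup>2))"])
    have "(\<integral>\<^sup>+(x, z). ennreal (exp (- 1 * (norm z)\<^sup>2)) \<partial>(\<mu> \<Otimes>\<^sub>M (lborel :: 'a measure))) = (\<integral>\<^sup>+x. ennreal (pi powr (DIM('a) / 2)) \<partial>\<mu>)"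
      unfolding G[symmetric] by (subst lborel.nn_integral_fst[symmetric]) auto
    also have "\<dots> < \<infinity>" by (simp add: ennreal_mult_eq_top_iff emeasure_finite less_top[symmetric])
    finally show "(\<integral>\<^sup>+(x, z). ennreal (exp (- 1 * (norm z)\<^sup>2)) \<partial>(\<mu> \<Otimes>\<^sub>M (lborel :: 'a measure))) < \<infinity>" .
    show "AE xz in \<mu> \<Otimes>\<^sub>M lborel. (\<lambda>k. case xz of (x, z) \<Rightarrow> ennreal (f (x + z /\<^sub>R real (Suc k)) * exp (- 1 * (norm z)\<^sup>2)))
        \<longlonglongrightarrow> (case xz of (x, z) \<Rightarrow> ennreal (f x * exp (- 1 * (norm z)\<^sup>2)))"
    proof (rule AE_I2, clarify)
      fix x z :: 'a
      have "(\<lambda>k. x + z /\<^sub>R real (Suc k)) \<longlonglongrightarrow> x + 0 *\<^sub>R z"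
        by (intro tendsto_intros LIMSEQ_inverse_real_of_nat)
      hence "(\<lambda>k. f (x + z /\<^sub>R real (Suc k))) \<longlonglongrightarrow> f x"
        using f(1) by (intro isCont_tendsto_compose[of x f]) (auto simp: continuous_on_eq_continuous_at)
      thus "(\<lambda>k. ennreal (f (x + z /\<^sub>R real (Suc k)) * exp (- 1 * (norm z)\<^sup>2))) \<longlonglongrightarrow> ennreal (f x * exp (- 1 * (norm z)\<^sup>2))"
        by (intro tendsto_ennrealI tendsto_mult_right)
    qed
  qed (auto intro!: ennreal_leI mult_left_le_one_le simp: f)
  moreover have "(\<integral>\<^sup>+(x, z). ennreal (f (x + z /\<^sub>R real (Suc k)) * exp (- 1 * (norm z)\<^sup>2)) \<partial>(\<mu> \<Otimes>\<^sub>M lborel))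
      = (\<integral>\<^sup>+x. (\<integral>\<^sup>+z. ennreal (f (x + z /\<^sub>R real (Suc k)) * exp (- 1 * (norm z)\<^sup>2)) \<partial>lborel) \<partial>\<mu>)" for k
    by (subst lborel.nn_integral_fst[symmetric]) auto
  moreover have "(\<integral>\<^sup>+(x, z). ennreal (f x * exp (- 1 * (norm z)\<^sup>2)) \<partial>(\<mu> \<Otimes>\<^sub>M (lborel :: 'a measure)))
      = (\<integral>\<^sup>+x. ennreal (f x) \<partial>\<mu>) * ennreal (pi powr (DIM('a) / 2))"
    unfolding G[symmetric]
    by (subst lborel.nn_integral_fst[symmetric]) (auto simp: ennreal_mult' f nn_integral_cmult nn_integral_multc)
  ultimately show ?thesis by simp
qed

text \<open>The substitution y = x + z / k, with Jacobian k^d, and an exchange of integrals move the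
  kernel from f to the measure. What remains involves the measure only through its Gaussian
  integrals.\<close>

lemma nn_integral_gaussian_average_eq:
  fixes \<mu> :: "'a::euclidean_space measure" and f :: "'a \<Rightarrow> real"
  assumes \<mu>: "finite_measure \<mu>" and sets[measurable_cong]: "sets \<mu> = sets borel"
    and [measurable]: "f \<in> borel_measurable borel" and f: "\<And>x. 0 \<le> f x" and k: "k > 0"
  shows "(\<integral>\<^sup>+x. (\<integral>\<^sup>+z. ennreal (f (x + z /\<^sub>R k) * exp (- 1 * (norm z)\<^sup>2)) \<partial>lborel) \<partial>\<mu>)
      = ennreal (k ^ DIM('a)) * (\<integral>\<^sup>+y. ennreal (f y) * ennreal (LINT x|\<mu>. exp (- k\<^sup>2 * (norm (x - y))\<^sup>2)) \<partial>lborel)"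
proof -
  interpret finite_measure \<mu> by fact
  interpret pair_sigma_finite \<mu> "lborel :: 'a measure" ..
  have "(\<integral>\<^sup>+z. ennreal (f (x + z /\<^sub>R k) * exp (- 1 * (norm z)\<^sup>2)) \<partial>lborel)
      = ennreal (k ^ DIM('a)) * (\<integral>\<^sup>+y. ennreal (f y) * ennreal (exp (- k\<^sup>2 * (norm (x - y))\<^sup>2)) \<partial>lborel)" for x
  proof -
    have inv: "x + (- (k *\<^sub>R x) + k *\<^sub>R y) /\<^sub>R k = y" for y
      using k by (simp add: scaleR_diff_right)
    have nrm: "norm (- (k *\<^sub>R x) + k *\<^sub>R y) = k * norm (x - y)" for y
    proof -
      have "- (k *\<^sub>R x) + k *\<^sub>R y = k *\<^sub>R (y - x)" by (simp add: scaleR_diff_right)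
      thus ?thesis using k by (simp add: norm_minus_commute)
    qed
    have "(\<integral>\<^sup>+z. ennreal (f (x + z /\<^sub>R k) * exp (- 1 * (norm z)\<^sup>2)) \<partial>lborel)
       = (\<integral>\<^sup>+z. ennreal (f (x + z /\<^sub>R k) * exp (- 1 * (norm z)\<^sup>2)) \<partial>density (distr lborel borel (\<lambda>y. - (k *\<^sub>R x) + k *\<^sub>R y)) (\<lambda>_. ennreal (\<bar>k\<bar> ^ DIM('a))))"
      using k by (subst lborel_affine[of k "- (k *\<^sub>R x)"]) auto
    also have "\<dots> = (\<integral>\<^sup>+y. ennreal (k ^ DIM('a)) * ennreal (f (x + (- (k *\<^sub>R x) + k *\<^sub>R y) /\<^sub>R k) * exp (- 1 * (norm (- (k *\<^sub>R x) + k *\<^sub>R y))\<^sup>2)) \<partial>lborel)"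
      using k by (simp add: nn_integral_density nn_integral_distr)
    also have "\<dots> = (\<integral>\<^sup>+y. ennreal (k ^ DIM('a)) * ennreal (f y * exp (- 1 * (k * norm (x - y))\<^sup>2)) \<partial>lborel)"
      unfolding inv nrm ..
    also have "\<dots> = ennreal (k ^ DIM('a)) * (\<integral>\<^sup>+y. ennreal (f y * exp (- 1 * (k * norm (x - y))\<^sup>2)) \<partial>lborel)"
      by (rule nn_integral_cmult) measurable
    finally show ?thesis by (simp add: power_mult_distrib ennreal_mult' f)
  qed
  hence "(\<integral>\<^sup>+x. (\<integral>\<^sup>+z. ennreal (f (x + z /\<^sub>R k) * exp (- 1 * (norm z)\<^sup>2)) \<partial>lborel) \<partial>\<mu>)
      = ennreal (k ^ DIM('a)) * (\<integral>\<^sup>+x. (\<integral>\<^sup>+y. ennreal (f y) * ennreal (exp (- k\<^sup>2 * (norm (x - y))\<^sup>2)) \<partial>lborel) \<partial>\<mu>)"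
    by (simp add: nn_integral_cmult)
  also have "(\<integral>\<^sup>+x. (\<integral>\<^sup>+y. ennreal (f y) * ennreal (exp (- k\<^sup>2 * (norm (x - y))\<^sup>2)) \<partial>lborel) \<partial>\<mu>)
      = (\<integral>\<^sup>+y. (\<integral>\<^sup>+x. ennreal (f y) * ennreal (exp (- k\<^sup>2 * (norm (x - y))\<^sup>2)) \<partial>\<mu>) \<partial>lborel)"
    by (rule Fubini'[symmetric]) measurable
  also have "\<dots> = (\<integral>\<^sup>+y. ennreal (f y) * ennreal (LINT x|\<mu>. exp (- k\<^sup>2 * (norm (x - y))\<^sup>2)) \<partial>lborel)"
  proof (rule nn_integral_cong)
    fix y
    have "integrable \<mu> (\<lambda>x. exp (- k\<^sup>2 * (norm (x - y))\<^sup>2))"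
      by (rule integrable_const_bound[of _ 1]) auto
    thus "(\<integral>\<^sup>+x. ennreal (f y) * ennreal (exp (- k\<^sup>2 * (norm (x - y))\<^sup>2)) \<partial>\<mu>) = ennreal (f y) * ennreal (LINT x|\<mu>. exp (- k\<^sup>2 * (norm (x - y))\<^sup>2))"
      by (subst nn_integral_cmult) (auto simp: nn_integral_eq_integral)
  qed
  finally show ?thesis .
qed

text \<open>Closed sets form an intersection-stable generator of the Borel sets, and the indicator
  of a closed set is the limit of the continuous functions max 0 (1 - k dist).\<close>

lemma measure_eqI_continuous:
  fixes \<mu> \<nu> :: "'a::metric_space measure"
  assumes \<mu>: "finite_measure \<mu>" and \<nu>: "finite_measure \<nu>"
    and sets: "sets \<mu> = sets borel" "sets \<nu> = sets borel"
    and eq: "\<And>f::'a \<Rightarrow> real. continuous_on UNIV f \<Longrightarrow> (\<And>x. 0 \<le> f x) \<Longrightarrow> (\<And>x. f x \<le> 1) \<Longrightarrow>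
       (\<integral>\<^sup>+x. ennreal (f x) \<partial>\<mu>) = (\<integral>\<^sup>+x. ennreal (f x) \<partial>\<nu>)"
  shows "\<mu> = \<nu>"
proof -
  have lim: "(\<lambda>k. \<integral>\<^sup>+x. ennreal (max 0 (1 - real k * infdist x A)) \<partial>N) \<longlonglongrightarrow> emeasure N A"
    if A: "closed A" "A \<noteq> {}" and N: "finite_measure N" and [measurable_cong]: "sets N = sets borel" for A and N :: "'a measure"
  proof -
    interpret finite_measure N by fact
    have [measurable]: "A \<in> sets borel" using A by simp
    have [measurable]: "(\<lambda>x. infdist x A) \<in> borel_measurable borel"
      by (intro borel_measurable_continuous_onI continuous_intros)
    have "(\<lambda>k. \<integral>\<^sup>+x. ennreal (max 0 (1 - real k * infdist x A)) \<partial>N) \<longlonglongrightarrow> (\<integral>\<^sup>+x. indicator A x \<partial>N)"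
    proof (rule nn_integral_dominated_convergence[where w = "\<lambda>_. 1"])
      show "AE x in N. (\<lambda>k. ennreal (max 0 (1 - real k * infdist x A))) \<longlonglongrightarrow> indicator A x"
      proof (rule AE_I2)
        fix x
        show "(\<lambda>k. ennreal (max 0 (1 - real k * infdist x A))) \<longlonglongrightarrow> indicator A x"
        proof (cases "x \<in> A")
          case True
          thus ?thesis by simp
        next
          case False
          hence pos: "infdist x A > 0" using A infdist_pos_not_in_closed by blast
          then obtain k0 where k0: "1 / infdist x A < real k0" using reals_Archimedean2 by blast
          have "eventually (\<lambda>k. ennreal (max 0 (1 - real k * infdist x A)) = indicator A x) sequentially"
            using eventually_ge_at_top[of k0]
          proof eventually_elim
            case (elim k)
            have "1 < real k0 * infdist x A" using k0 pos by (simp add: field_simps)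
            also have "\<dots> \<le> real k * infdist x A" using elim pos by (intro mult_right_mono) auto
            finally show ?case using False by simp
          qed
          thus ?thesis by (rule tendsto_eventually)
        qed
      qed
    qed (auto intro!: AE_I2 mult_nonneg_nonneg infdist_nonneg simp: emeasure_finite less_top[symmetric])
    thus ?thesis by simp
  qed
  interpret M: finite_measure \<mu> by fact
  show ?thesis
  proof (rule measure_eqI_generator_eq[where E = "Collect closed" and \<Omega> = UNIV and A = "\<lambda>_. UNIV"])
    show "Int_stable (Collect closed :: 'a set set)" by (auto simp: Int_stable_def)
    show "sets \<mu> = sigma_sets UNIV (Collect closed)" "sets \<nu> = sigma_sets UNIV (Collect closed)"
      using sets by (simp_all add: borel_eq_closed)
    fix A :: "'a set" assume "A \<in> Collect closed"
    hence A: "closed A" by simp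
    show "emeasure \<mu> A = emeasure \<nu> A"
    \<comment> \<open>\<open>infdist\<close> to the empty set is 0 by convention, so there the
      approximating functions would be constantly 1.\<close>
    proof (cases "A = {}")
      case False
      have "(\<lambda>k. \<integral>\<^sup>+x. ennreal (max 0 (1 - real k * infdist x A)) \<partial>\<mu>) = (\<lambda>k. \<integral>\<^sup>+x. ennreal (max 0 (1 - real k * infdist x A)) \<partial>\<nu>)"
        by (intro ext eq) (auto intro!: continuous_intros mult_nonneg_nonneg infdist_nonneg)
      with lim[OF A False \<mu> sets(1)] lim[OF A False \<nu> sets(2)] show ?thesis
        by (simp only:) (rule LIMSEQ_unique)
    qed simp
  qed (auto simp: M.emeasure_finite)
qed

text \<open>Equal transforms give equal Gaussian integrals at every centre and rate, hence equal
  Gaussian averages of every test function; letting the width shrink gives equal integrals of the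
  function itself.\<close>

theorem measure_eqI_fourier:
  fixes \<mu> \<nu> :: "'a::euclidean_space measure"
  assumes \<mu>: "finite_measure \<mu>" and \<nu>: "finite_measure \<nu>"
    and sets: "sets \<mu> = sets borel" "sets \<nu> = sets borel"
    and eq: "\<And>\<xi>. (CLINT x|\<mu>. iexp (\<xi> \<bullet> x)) = (CLINT x|\<nu>. iexp (\<xi> \<bullet> x))"
  shows "\<mu> = \<nu>"
proof (rule measure_eqI_continuous[OF \<mu> \<nu> sets])
  fix f :: "'a \<Rightarrow> real"
  assume f: "continuous_on UNIV f" "\<And>x. 0 \<le> f x" "\<And>x. f x \<le> 1"
  have fm: "f \<in> borel_measurable borel" using f(1) by (rule borel_measurable_continuous_onI)
  have gauss: "(LINT x|\<mu>. exp (- t * (norm (x - y))\<^sup>2)) = (LINT x|\<nu>. exp (- t * (norm (x - y))\<^sup>2))" if t: "t > 0" for t y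
  proof -
    have "complex_of_real ((4 * t * pi) powr (DIM('a) / 2) * (LINT x|\<mu>. exp (- t * (norm (x - y))\<^sup>2)))
       = complex_of_real ((4 * t * pi) powr (DIM('a) / 2) * (LINT x|\<nu>. exp (- t * (norm (x - y))\<^sup>2)))"
      unfolding integral_gaussian_eq_fourier[OF \<mu> sets(1) t] integral_gaussian_eq_fourier[OF \<nu> sets(2) t] eq ..
    thus ?thesis using t by (simp only: of_real_eq_iff mult_cancel_left) auto
  qed
  have "(\<lambda>k. \<integral>\<^sup>+x. (\<integral>\<^sup>+z. ennreal (f (x + z /\<^sub>R real (Suc k)) * exp (- 1 * (norm z)\<^sup>2)) \<partial>lborel) \<partial>\<mu>)
      = (\<lambda>k. \<integral>\<^sup>+x. (\<integral>\<^sup>+z. ennreal (f (x + z /\<^sub>R real (Suc k)) * exp (- 1 * (norm z)\<^sup>2)) \<partial>lborel) \<partial>\<nu>)"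
    by (intro ext)
       (simp only: nn_integral_gaussian_average_eq[OF \<mu> sets(1) fm f(2)] nn_integral_gaussian_average_eq[OF \<nu> sets(2) fm f(2)]
          of_nat_0_less_iff zero_less_Suc gauss zero_less_power)
  with nn_integral_gaussian_average_tendsto[OF \<mu> sets(1) f] nn_integral_gaussian_average_tendsto[OF \<nu> sets(2) f]
  have "(\<integral>\<^sup>+x. ennreal (f x) \<partial>\<mu>) * ennreal (pi powr (DIM('a) / 2)) = (\<integral>\<^sup>+x. ennreal (f x) \<partial>\<nu>) * ennreal (pi powr (DIM('a) / 2))"
    by (simp only:) (rule LIMSEQ_unique)
  moreover have "ennreal (pi powr (DIM('a) / 2)) \<noteq> 0"
    by (simp only: ennreal_eq_0_iff not_le) simp
  ultimately show "(\<integral>\<^sup>+x. ennreal (f x) \<partial>\<mu>) = (\<integral>\<^sup>+x. ennreal (f x) \<partial>\<nu>)"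
    by (subst (asm) (1 2) mult.commute, subst (asm) ennreal_mult_cancel_left) auto
qed

section \<open>Bounded Lipschitz test functions\<close>

lemma sets_stable_levy [measurable_cong, simp]: "sets (stable_levy \<alpha>) = sets borel"
  by (simp add: stable_levy_def)

lemma sigma_finite_stable_levy: "sigma_finite_measure (stable_levy \<alpha>)"
  unfolding stable_levy_def by (subst sigma_finite_measure.sigma_finite_iff_density_finite[OF sigma_finite_lborel]) auto

text \<open>The density is positive away from the origin, so the two measures have the same null
  sets. This turns vanishing energy into a statement about Lebesgue measure.\<close>

lemma AE_stable_levy_iff:
  fixes P :: "real ^ 'd \<Rightarrow> bool"
  assumes "1 < \<alpha>" "\<alpha> < 2"
  shows "(AE u in stable_levy \<alpha>. P u) \<longleftrightarrow> (AE u in lborel. P u)"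
proof -
  have "(AE u in stable_levy \<alpha>. P u) \<longleftrightarrow> (AE u in lborel. u \<noteq> 0 \<longrightarrow> P u)"
    unfolding stable_levy_def using stable_const_pos[OF assms, of "CARD('d)"]
    by (subst AE_density) (auto simp: zero_less_divide_iff)
  also have "\<dots> \<longleftrightarrow> (AE u in lborel. P u)"
  proof
    assume "AE u in lborel. u \<noteq> 0 \<longrightarrow> P u"
    with AE_lborel_singleton[of "0 :: real ^ 'd"] show "AE u in lborel. P u"
      by eventually_elim auto
  qed auto
  finally show ?thesis .
qed

text \<open>The density depends on u through its norm only. Consequently odd integrands have
  integral 0.\<close>

lemma stable_levy_integral_reflect:
  fixes f :: "real ^ 'd \<Rightarrow> real"
  assumes "1 < \<alpha>" "\<alpha> < 2" and [measurable]: "f \<in> borel_measurable borel"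
  shows "(LINT u|stable_levy \<alpha>. f (- u)) = (LINT u|stable_levy \<alpha>. f u)"
proof -
  have "distr lborel borel (uminus :: real ^ 'd \<Rightarrow> _) = lborel"
    using lborel_affine[of "-1" "0 :: real ^ 'd"] by (simp add: density_1)
  hence "(LINT u|lborel. stable_const \<alpha> CARD('d) / norm u powr (CARD('d) + \<alpha>) * f u)
     = (LINT u|distr lborel borel (uminus :: real ^ 'd \<Rightarrow> _). stable_const \<alpha> CARD('d) / norm u powr (CARD('d) + \<alpha>) * f u)"
    by simp
  also have "\<dots> = (LINT u|lborel. stable_const \<alpha> CARD('d) / norm u powr (CARD('d) + \<alpha>) * f (- u))"
    by (subst integral_distr) auto
  finally show ?thesis
    unfolding stable_levy_def using stable_const_pos[OF assms(1,2), of "CARD('d)"]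
    by (simp add: integral_density)
qed

text \<open>The class is stable under linear combinations, contains the truncated coordinates and
  the cosines, and has finite energy and variance under every Borel probability measure.\<close>

definition bounded_lipschitz :: "('a::real_normed_vector \<Rightarrow> real) \<Rightarrow> bool" where
  "bounded_lipschitz f \<longleftrightarrow> (\<exists>B L. (\<forall>x. \<bar>f x\<bar> \<le> B) \<and> (\<forall>x y. \<bar>f x - f y\<bar> \<le> L * norm (x - y)))"

lemma bounded_lipschitzI:
  assumes "\<And>x. \<bar>f x\<bar> \<le> B" "\<And>x y. \<bar>f x - f y\<bar> \<le> L * norm (x - y)"
  shows "bounded_lipschitz f"
  using assms unfolding bounded_lipschitz_def by blast

lemma bounded_lipschitz_add_cmult:
  assumes "bounded_lipschitz f" "bounded_lipschitz g"
  shows "bounded_lipschitz (\<lambda>x. f x + s * g x)"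
proof -
  obtain B L where f: "\<And>x. \<bar>f x\<bar> \<le> B" "\<And>x y. \<bar>f x - f y\<bar> \<le> L * norm (x - y)"
    using assms(1) unfolding bounded_lipschitz_def by blast
  obtain B' L' where g: "\<And>x. \<bar>g x\<bar> \<le> B'" "\<And>x y. \<bar>g x - g y\<bar> \<le> L' * norm (x - y)"
    using assms(2) unfolding bounded_lipschitz_def by blast
  show ?thesis
  proof (rule bounded_lipschitzI)
    fix x y
    have "\<bar>s * g x\<bar> \<le> \<bar>s\<bar> * B'" unfolding abs_mult by (intro mult_left_mono g) auto
    thus "\<bar>f x + s * g x\<bar> \<le> B + \<bar>s\<bar> * B'" using f(1)[of x] by linarith
    have "\<bar>s * (g x - g y)\<bar> \<le> \<bar>s\<bar> * (L' * norm (x - y))" unfolding abs_mult by (intro mult_left_mono g) auto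
    thus "\<bar>f x + s * g x - (f y + s * g y)\<bar> \<le> (L + \<bar>s\<bar> * L') * norm (x - y)"
      using f(2)[of x y] by (simp add: algebra_simps)
  qed
qed

lemma bounded_lipschitz_continuous:
  assumes "bounded_lipschitz f"
  shows "continuous_on UNIV f"
proof -
  obtain B L where "\<And>x y. \<bar>f x - f y\<bar> \<le> L * norm (x - y)"
    using assms(1) unfolding bounded_lipschitz_def by blast
  hence "\<bar>L\<bar>-lipschitz_on UNIV f"
    by (intro lipschitz_onI)
       (auto simp: dist_norm intro!: order_trans[OF _ mult_right_mono[OF abs_ge_self]])
  thus ?thesis by (rule lipschitz_on_continuous_on)
qed

lemma bounded_lipschitz_measurable:
  fixes f :: "real ^ 'd \<Rightarrow> real"
  shows "bounded_lipschitz f \<Longrightarrow> f \<in> borel_measurable borel"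
  by (intro borel_measurable_continuous_onI bounded_lipschitz_continuous)

lemma bounded_lipschitz_increment:
  assumes "bounded_lipschitz f"
  obtains C where "C \<ge> 0" "\<And>x u. \<bar>f (x + u) - f x\<bar> \<le> C * min 1 (norm u)"
proof -
  obtain B L where f: "\<And>x. \<bar>f x\<bar> \<le> B" "\<And>x y. \<bar>f x - f y\<bar> \<le> L * norm (x - y)"
    using assms unfolding bounded_lipschitz_def by blast
  define C where "C = max (2 * B) \<bar>L\<bar>"
  show thesis
  proof
    show C: "C \<ge> 0" by (simp add: C_def)
    fix x u
    have "\<bar>f (x + u) - f x\<bar> \<le> 2 * B" using f(1)[of x] f(1)[of "x + u"] by linarith
    hence 1: "\<bar>f (x + u) - f x\<bar> \<le> C" by (simp add: C_def)
    have "L \<le> C" by (simp add: C_def)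
    hence "\<bar>f (x + u) - f x\<bar> \<le> C * norm u"
      using f(2)[of "x + u" x] order_trans[OF _ mult_right_mono[of L C "norm u"]] by simp
    with 1 show "\<bar>f (x + u) - f x\<bar> \<le> C * min 1 (norm u)"
      by (auto simp: min_def)
  qed
qed

lemma bounded_lipschitz_cos:
  fixes w :: "'a::real_inner"
  shows "bounded_lipschitz (\<lambda>x. cos (w \<bullet> x + c))"
proof (rule bounded_lipschitzI)
  show "\<bar>cos (w \<bullet> x + c)\<bar> \<le> 1" for x by simp
  fix x y
  define a b where "a = w \<bullet> x + c" and "b = w \<bullet> y + c"
  have "cos a - cos b = 2 * sin ((a + b) / 2) * sin ((b - a) / 2)" by (rule cos_diff_cos)
  hence "\<bar>cos a - cos b\<bar> = 2 * (\<bar>sin ((a + b) / 2)\<bar> * \<bar>sin ((b - a) / 2)\<bar>)"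
    by (simp add: abs_mult)
  also have "\<dots> \<le> 2 * (1 * \<bar>(b - a) / 2\<bar>)"
    by (intro mult_left_mono mult_mono abs_sin_x_le_abs_x) auto
  also have "\<dots> = \<bar>w \<bullet> (x - y)\<bar>" by (simp add: a_def b_def inner_diff_right)
  also have "\<dots> \<le> norm w * norm (x - y)" by (rule Cauchy_Schwarz_ineq2)
  finally show "\<bar>cos (w \<bullet> x + c) - cos (w \<bullet> y + c)\<bar> \<le> norm w * norm (x - y)"
    by (simp add: a_def b_def)
qed

section \<open>Truncated coordinates: bounds uniform in the radius\<close>

lemma g_trunc_le: "\<bar>g_trunc R j x\<bar> \<le> \<bar>x $ j\<bar>"
  by (simp add: g_trunc_def psi_def abs_mult mult_left_le)

text \<open>By the product rule the coordinate contributes at most 1 to the derivative, and the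
  Gaussian factor at most 2 q exp (- q) <= 2 with q = |x|^2 / R^2. That R disappears is what allows
  dominated convergence later.\<close>

lemma g_trunc_lipschitz:
  fixes x y :: "real ^ 'd"
  assumes R: "R > 0"
  shows "\<bar>g_trunc R j x - g_trunc R j y\<bar> \<le> 3 * norm (x - y)"
proof -
  define c where "c = inverse (R\<^sup>2)"
  define e where "e x = exp (- (c * (x \<bullet> x)))" for x :: "real ^ 'd"
  have eq: "g_trunc R j = (\<lambda>x. x $ j * e x)"
    using R by (auto simp: g_trunc_def psi_def e_def c_def power_mult_distrib power2_norm_eq_inner field_simps)
  define D where "D x v = v $ j * e x - x $ j * (e x * (c * (2 * (x \<bullet> v))))" for x v :: "real ^ 'd"
  have "norm (g_trunc R j x - g_trunc R j y) \<le> 3 * norm (x - y)"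
  proof (rule differentiable_bound[where S = UNIV and f' = D])
    fix x :: "real ^ 'd"
    have vj: "((\<lambda>x::real ^ 'd. x $ j) has_derivative (\<lambda>v. v $ j)) (at x)"
      by (rule bounded_linear_imp_has_derivative) (rule bounded_linear_vec_nth)
    show "(g_trunc R j has_derivative D x) (at x)"
      unfolding eq e_def D_def
      by (auto intro!: derivative_eq_intros vj simp: inner_commute field_simps)
    show "onorm (D x) \<le> 3"
    proof (rule onorm_le)
      fix v
      define q where "q = c * (norm x)\<^sup>2"
      have e: "e x = exp (- q)" by (simp add: e_def q_def power2_norm_eq_inner)
      have q: "q * exp (- q) \<le> 1"
      proof -
        have "q \<le> exp q" using exp_ge_add_one_self[of q] by linarith
        thus ?thesis by (simp add: exp_minus divide_inverse[symmetric] divide_le_eq)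
      qed
      have c0: "c \<ge> 0" by (simp add: c_def)
      hence q0: "q \<ge> 0" by (simp add: q_def)
      have "\<bar>v $ j * e x\<bar> \<le> norm v * 1"
        unfolding abs_mult using component_le_norm_cart[of v j] q0 by (intro mult_mono) (auto simp: e)
      moreover have "\<bar>x $ j * (e x * (c * (2 * (x \<bullet> v))))\<bar> \<le> 2 * norm v"
      proof -
        have "\<bar>x $ j * (e x * (c * (2 * (x \<bullet> v))))\<bar> = (\<bar>x $ j\<bar> * \<bar>x \<bullet> v\<bar>) * (2 * e x * c)"
          using c0 by (simp add: abs_mult e)
        also have "\<dots> \<le> (norm x * (norm x * norm v)) * (2 * e x * c)"
          using component_le_norm_cart[of x j] Cauchy_Schwarz_ineq2[of x v] c0
          by (intro mult_right_mono mult_mono) (auto simp: e)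
        also have "\<dots> = 2 * norm v * (q * exp (- q))"
          by (simp add: e q_def power2_eq_square)
        also have "\<dots> \<le> 2 * norm v * 1" using q by (intro mult_left_mono) auto
        finally show ?thesis by simp
      qed
      ultimately show "norm (D x v) \<le> 3 * norm v" unfolding D_def real_norm_def by linarith
    qed
  qed auto
  thus ?thesis by simp
qed

lemma bounded_lipschitz_g_trunc:
  fixes j :: "'d::finite"
  assumes "R > 0"
  shows "bounded_lipschitz (g_trunc R j)"
proof (rule bounded_lipschitzI[OF _ g_trunc_lipschitz[OF assms]])
  fix x :: "real ^ 'd"
  define y where "y = norm x / R"
  have "\<bar>g_trunc R j x\<bar> \<le> norm x * exp (- y\<^sup>2)"
    unfolding g_trunc_def psi_def abs_mult using component_le_norm_cart[of x j] assms
    by (intro mult_mono) (auto simp: y_def divide_inverse mult.commute)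
  also have "\<dots> = R * (y * exp (- y\<^sup>2))" using assms by (simp add: y_def)
  also have "\<dots> \<le> R * 1"
  proof (intro mult_left_mono)
    have "y \<le> 1 + y\<^sup>2" using sum_squares_bound[of 1 y] by (simp) (smt (verit) zero_le_power2)
    also have "\<dots> \<le> exp (y\<^sup>2)" by (rule exp_ge_add_one_self)
    finally show "y * exp (- y\<^sup>2) \<le> 1"
      by (simp add: exp_minus divide_inverse[symmetric] divide_le_eq)
  qed (use assms in auto)
  finally show "\<bar>g_trunc R j x\<bar> \<le> R" by simp
qed

lemma g_trunc_tendsto:
  "(\<lambda>n. g_trunc (real (Suc n)) j x) \<longlonglongrightarrow> x $ j"
proof -
  have "(\<lambda>n. x $ j * exp (- (inverse (real (Suc n)) * norm x)\<^sup>2)) \<longlonglongrightarrow> x $ j * exp (- (0 * norm x)\<^sup>2)"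
    by (intro tendsto_intros LIMSEQ_inverse_real_of_nat)
  thus ?thesis by (simp add: g_trunc_def psi_def)
qed

section \<open>The quadratic form and its Euler equation\<close>

lemma mult_min_one:
  fixes x :: real
  assumes "0 \<le> x"
  shows "x * min 1 x = min x (x\<^sup>2)"
  using assms by (simp add: min_mult_distrib_left power2_eq_square)

locale stable_form = prob_space \<mu>
  for \<mu> :: "(real ^ 'd) measure" +
  fixes \<alpha> :: real
  assumes \<alpha>: "1 < \<alpha>" "\<alpha> < 2" and sets_\<mu> [measurable_cong, simp]: "sets \<mu> = sets borel"
begin

sublocale levy: sigma_finite_measure "stable_levy \<alpha> :: (real ^ 'd) measure"
  by (rule sigma_finite_stable_levy)

sublocale P: pair_sigma_finite \<mu> "stable_levy \<alpha> :: (real ^ 'd) measure" ..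

text \<open>A point of this product is a base point x with a jump u; the double integral in
  \<open>energy\<close> becomes a single one.\<close>

abbreviation P where "P \<equiv> \<mu> \<Otimes>\<^sub>M (stable_levy \<alpha> :: (real ^ 'd) measure)"

lemma space_\<mu> [simp]: "space \<mu> = UNIV"
  using sets_eq_imp_space_eq[OF sets_\<mu>] by simp

lemma integrable_prod_mult:
  fixes f g :: "real ^ 'd \<Rightarrow> real"
  assumes f: "integrable \<mu> f" and g: "integrable (stable_levy \<alpha>) g"
  shows "integrable P (\<lambda>(x, u). f x * g u)"
proof (rule P.Fubini_integrable)
  have [measurable]: "f \<in> borel_measurable borel" "g \<in> borel_measurable borel"
    using borel_measurable_integrable[OF f] borel_measurable_integrable[OF g] by simp_all
  show "(\<lambda>(x, u). f x * g u) \<in> borel_measurable P" by measurable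
  show "integrable \<mu> (\<lambda>x. LINT u|stable_levy \<alpha>. norm (case (x, u) of (x, u) \<Rightarrow> f x * g u))"
    using f by (simp add: abs_mult)
qed (use g in auto)

lemma integral_prod_mult:
  fixes f g :: "real ^ 'd \<Rightarrow> real"
  assumes f: "integrable \<mu> f" and g: "integrable (stable_levy \<alpha>) g"
  shows "(LINT xu|P. f (fst xu) * g (snd xu)) = (LINT x|\<mu>. f x) * (LINT u|stable_levy \<alpha>. g u)"
  using P.integral_fst'[OF integrable_prod_mult[OF assms]] by (simp add: case_prod_unfold)

lemma integrable_min_P: "integrable P (\<lambda>xu. min (norm (snd xu)) ((norm (snd xu))\<^sup>2))"
  using integrable_prod_mult[OF integrable_const[of 1] stable_levy_integrable_min[OF \<alpha>]]
  by (simp add: case_prod_unfold)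

lemma integrable_P_bound:
  fixes F :: "(real ^ 'd) \<times> (real ^ 'd) \<Rightarrow> real"
  assumes "F \<in> borel_measurable P" "\<And>x u. \<bar>F (x, u)\<bar> \<le> C * min (norm u) ((norm u)\<^sup>2)"
  shows "integrable P F"
proof (rule Bochner_Integration.integrable_bound)
  show "integrable P (\<lambda>xu. C * min (norm (snd xu)) ((norm (snd xu))\<^sup>2))"
    by (intro integrable_mult_right integrable_min_P)
  show "AE xu in P. norm (F xu) \<le> norm (C * min (norm (snd xu)) ((norm (snd xu))\<^sup>2))"
    by (intro AE_I2) (metis assms(2) abs_ge_self order_trans prod.collapse real_norm_def)
qed (rule assms)

definition incr :: "(real ^ 'd \<Rightarrow> real) \<Rightarrow> (real ^ 'd) \<times> (real ^ 'd) \<Rightarrow> real" where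
  "incr f xu = f (fst xu + snd xu) - f (fst xu)"

lemma measurable_incr [measurable]:
  assumes [measurable]: "f \<in> borel_measurable borel"
  shows "incr f \<in> borel_measurable P"
  unfolding incr_def[abs_def] by measurable

lemma bl_integrable: "bounded_lipschitz f \<Longrightarrow> integrable \<mu> f"
proof -
  assume f: "bounded_lipschitz f"
  then obtain B where "\<And>x. \<bar>f x\<bar> \<le> B" by (auto simp: bounded_lipschitz_def)
  thus "integrable \<mu> f"
    using bounded_lipschitz_measurable[OF f] by (intro integrable_const_bound[of _ B]) auto
qed

lemma bl_integrable_mult:
  assumes "bounded_lipschitz f" "integrable \<mu> g"
  shows "integrable \<mu> (\<lambda>x. f x * g x)"
proof -
  obtain B where B: "\<And>x. \<bar>f x\<bar> \<le> B" using assms(1) by (auto simp: bounded_lipschitz_def)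
  have [measurable]: "f \<in> borel_measurable borel" using assms(1) by (rule bounded_lipschitz_measurable)
  show ?thesis
  proof (rule Bochner_Integration.integrable_bound)
    show "integrable \<mu> (\<lambda>x. B * norm (g x))" using assms(2) by auto
    show "AE x in \<mu>. norm (f x * g x) \<le> norm (B * norm (g x))"
    proof (rule AE_I2)
      fix x
      have "norm (f x * g x) \<le> B * norm (g x)"
        unfolding norm_mult using B by (intro mult_right_mono) auto
      thus "norm (f x * g x) \<le> norm (B * norm (g x))" by simp
    qed
  qed (use borel_measurable_integrable[OF assms(2)] in simp)
qed

text \<open>The product of two increments is at most a multiple of (min 1 |u|)^2, which is |u|^2 for
  small jumps and 1 for large ones, hence below min |u| |u|^2.\<close>

lemma bl_integrable_incr:
  assumes "bounded_lipschitz f" "bounded_lipschitz h"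
  shows "integrable P (\<lambda>xu. incr f xu * incr h xu)"
proof -
  have [measurable]: "f \<in> borel_measurable borel" "h \<in> borel_measurable borel"
    using assms by (simp_all add: bounded_lipschitz_measurable)
  obtain C where C: "C \<ge> 0" "\<And>x u. \<bar>f (x + u) - f x\<bar> \<le> C * min 1 (norm u)"
    using bounded_lipschitz_increment[OF assms(1)] by blast
  obtain D where D: "D \<ge> 0" "\<And>x u. \<bar>h (x + u) - h x\<bar> \<le> D * min 1 (norm u)"
    using bounded_lipschitz_increment[OF assms(2)] by blast
  show ?thesis
  proof (rule integrable_P_bound[of _ "C * D"])
    fix x u :: "real ^ 'd"
    have "\<bar>incr f (x, u) * incr h (x, u)\<bar> \<le> (C * min 1 (norm u)) * (D * min 1 (norm u))"
      unfolding incr_def abs_mult using C D by (intro mult_mono) auto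
    also have "\<dots> = (C * D) * (min 1 (norm u))\<^sup>2" by (simp add: power2_eq_square)
    also have "\<dots> \<le> (C * D) * min (norm u) ((norm u)\<^sup>2)"
    proof (rule mult_left_mono)
      show "(min 1 (norm u))\<^sup>2 \<le> min (norm u) ((norm u)\<^sup>2)"
      proof (cases "norm u \<le> 1")
        case True
        hence "norm u * norm u \<le> norm u" by (intro mult_left_le) auto
        with True show ?thesis by (simp add: min_def power2_eq_square)
      next
        case False
        hence "norm u * 1 \<le> norm u * norm u" by (intro mult_left_mono) auto
        with False show ?thesis by (simp add: min_def power2_eq_square)
      qed
    qed (use C D in auto)
    finally show "\<bar>incr f (x, u) * incr h (x, u)\<bar> \<le> (C * D) * min (norm u) ((norm u)\<^sup>2)" .
  qed measurable
qed

text \<open>The polarised energy, real-valued so that squares can be expanded with subtraction; it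
  agrees with \<open>energy\<close> on bounded Lipschitz functions, where the integral is
  finite.\<close>

definition E where "E f h = (LINT xu|P. incr f xu * incr h xu)"
definition Cv where "Cv f h = expectation (\<lambda>x. f x * h x) - expectation f * expectation h"

lemma energy_eq:
  assumes "bounded_lipschitz f"
  shows "energy \<alpha> \<mu> f = ennreal (E f f)"
proof -
  have [measurable]: "f \<in> borel_measurable borel" using assms by (rule bounded_lipschitz_measurable)
  have "energy \<alpha> \<mu> f = (\<integral>\<^sup>+xu. ennreal (incr f xu * incr f xu) \<partial>P)"
    unfolding energy_def
    by (subst levy.nn_integral_fst[symmetric]) (auto simp: incr_def power2_eq_square)
  also have "\<dots> = ennreal (E f f)"
    unfolding E_def using bl_integrable_incr[OF assms assms] by (intro nn_integral_eq_integral) auto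
  finally show ?thesis .
qed

lemma E_nonneg: "E f f \<ge> 0"
  unfolding E_def by (intro integral_nonneg_AE) auto

lemma variance_eq_Cv:
  assumes "bounded_lipschitz f"
  shows "variance f = Cv f f"
  unfolding Cv_def
  using bl_integrable[OF assms] bl_integrable_mult[OF assms bl_integrable[OF assms]]
  by (subst variance_eq) (auto simp: power2_eq_square)

text \<open>Zero energy means that almost every increment vanishes. From one fixed base point this
  says that f is constant off a Lebesgue null set, and continuity removes the null set.\<close>

lemma constant_if_E_zero:
  assumes f: "bounded_lipschitz f" and 0: "E f f = 0"
  obtains c where "\<And>x. f x = c"
proof -
  have "AE xu in P. incr f xu * incr f xu = 0"
    using integral_nonneg_eq_0_iff_AE[OF bl_integrable_incr[OF f f]] 0 unfolding E_def by auto
  hence "AE x in \<mu>. AE u in stable_levy \<alpha>. incr f (x, u) * incr f (x, u) = 0"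
    by (rule P.AE_pair)
  \<comment> \<open>Such a base point exists because a probability measure is not the zero
    measure.\<close>
  then obtain x where x: "AE u in stable_levy \<alpha>. incr f (x, u) * incr f (x, u) = 0"
    using eventually_happens[OF _ ] AE_E3 by (metis (mono_tags, lifting) UNIV_I ae_filter_eq_bot_iff emeasure_space_1 eventually_happens zero_neq_one)
  hence "AE u in lborel. f (x + u) = f x"
    by (simp add: AE_stable_levy_iff[OF \<alpha>] incr_def)
  \<comment> \<open>The set of good increments is closed and has null complement, so it is the whole
    space.\<close>
  hence "AE u in lebesgue. u \<in> {u. f (x + u) = f x}"
    by (simp add: AE_completion)
  moreover have "closed {u. f (x + u) = f x}"
    by (intro closed_Collect_eq continuous_on_const continuous_on_compose2[OF bounded_lipschitz_continuous[OF f]] continuous_intros) auto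
  ultimately have "u \<in> {u. f (x + u) = f x}" for u
    by (metis mem_closed_if_AE_lebesgue)
  hence "f y = f x" for y
    by (metis (mono_tags, lifting) add.commute diff_add_cancel mem_Collect_eq)
  thus thesis by (rule that)
qed

text \<open>For positive energy the ratio is one of those in the supremum. Functions of zero energy
  lie outside \<open>H_class\<close> and are treated separately: they are constant, so their
  variance is 0 as well.\<close>

lemma Cv_le_E:
  assumes U: "U_functional \<alpha> \<mu> = 1" and f: "bounded_lipschitz f"
  shows "Cv f f \<le> E f f"
proof (cases "E f f = 0")
  case True
  then obtain c where "\<And>x. f x = c" using constant_if_E_zero[OF f] by blast
  hence "f = (\<lambda>_. c)" by auto
  thus ?thesis using True by (simp add: Cv_def prob_space[unfolded space_\<mu>])
next
  case False
  hence pos: "E f f > 0" using E_nonneg[of f] by simp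
  have [measurable]: "f \<in> borel_measurable borel" using f by (rule bounded_lipschitz_measurable)
  have "finite_variance \<mu> f"
    using bl_integrable[OF f] bl_integrable_mult[OF f bl_integrable[OF f]]
    by (auto simp: finite_variance_def power2_diff power2_eq_square[symmetric])
  hence "f \<in> H_class \<alpha> \<mu>"
    using pos by (auto simp: H_class_def energy_eq[OF f])
  hence "ennreal (variance f) / energy \<alpha> \<mu> f \<le> 1"
    unfolding U[symmetric] U_functional_def by (rule SUP_upper)
  hence "ennreal (Cv f f / E f f) \<le> ennreal 1"
    using pos variance_positive[of f]
    by (simp add: energy_eq[OF f] variance_eq_Cv[OF f] divide_ennreal)
  hence "Cv f f / E f f \<le> 1" by (subst (asm) ennreal_le_iff) auto
  thus ?thesis using pos by (simp add: divide_le_eq)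
qed

lemma quadratic_nonneg:
  assumes U: "U_functional \<alpha> \<mu> = 1" and f: "bounded_lipschitz f" and h: "bounded_lipschitz h"
  shows "0 \<le> (E f f - Cv f f) + 2 * s * (E f h - Cv f h) + s\<^sup>2 * (E h h - Cv h h)"
proof -
  define k where "k = (\<lambda>x. f x + s * h x)"
  have k: "bounded_lipschitz k" unfolding k_def by (rule bounded_lipschitz_add_cmult[OF f h])
  note int = bl_integrable_incr[OF f f] bl_integrable_incr[OF f h] bl_integrable_incr[OF h h]
  note int' = bl_integrable[OF f] bl_integrable[OF h] bl_integrable_mult[OF f bl_integrable[OF f]]
    bl_integrable_mult[OF f bl_integrable[OF h]] bl_integrable_mult[OF h bl_integrable[OF h]]
  have "incr k xu * incr k xu = incr f xu * incr f xu + (2 * s * (incr f xu * incr h xu) + s\<^sup>2 * (incr h xu * incr h xu))" for xu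
    by (simp add: incr_def k_def algebra_simps power2_eq_square)
  hence "E k k = E f f + (2 * s * E f h + s\<^sup>2 * E h h)"
    unfolding E_def using int by simp
  moreover have "k x * k x = f x * f x + (2 * s * (f x * h x) + s\<^sup>2 * (h x * h x))" for x
    by (simp add: k_def algebra_simps power2_eq_square)
  hence "expectation (\<lambda>x. k x * k x) = expectation (\<lambda>x. f x * f x) + (2 * s * expectation (\<lambda>x. f x * h x) + s\<^sup>2 * expectation (\<lambda>x. h x * h x))"
    using int' by simp
  moreover have "expectation k = expectation f + s * expectation h"
    unfolding k_def using int' by simp
  moreover have "Cv k k \<le> E k k" by (rule Cv_le_E[OF U k])
  ultimately show ?thesis
    unfolding Cv_def by (simp add: algebra_simps power2_eq_square)
qed

text \<open>Positivity of the form at \<open>g_trunc\<close> + s h survives the limit for each fixed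
  s. Its constant term tends to 0 by hypothesis, so the limit is a quadratic in s without constant
  term, which is nonnegative for all real s only if the linear coefficient is 0.\<close>

lemma
  fixes j :: 'd
  assumes U: "U_functional \<alpha> \<mu> = 1" and h: "bounded_lipschitz h"
    and int: "integrable \<mu> (\<lambda>x. x $ j)" and centred: "expectation (\<lambda>x. x $ j) = 0"
    and lim: "(\<lambda>n. E (g_trunc (real (Suc n)) j) (g_trunc (real (Suc n)) j)
        - Cv (g_trunc (real (Suc n)) j) (g_trunc (real (Suc n)) j)) \<longlonglongrightarrow> 0"
  shows integrable_coord_incr: "integrable P (\<lambda>xu. snd xu $ j * incr h xu)" (is ?int)
    and euler_coord: "(LINT xu|P. snd xu $ j * incr h xu) = expectation (\<lambda>x. x $ j * h x)" (is ?eq)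
proof -
  define g where "g n = g_trunc (real (Suc n)) j" for n
  have g: "bounded_lipschitz (g n)" for n
    unfolding g_def by (rule bounded_lipschitz_g_trunc) simp
  note [measurable] = bounded_lipschitz_measurable[OF h] bounded_lipschitz_measurable[OF g]
  have [measurable]: "(\<lambda>x::real ^ 'd. x $ j) \<in> borel_measurable borel"
    by (intro borel_measurable_continuous_onI continuous_intros)
  obtain D where D: "D \<ge> 0" "\<And>x u. \<bar>h (x + u) - h x\<bar> \<le> D * min 1 (norm u)"
    using bounded_lipschitz_increment[OF h] by blast
  have bound: "\<bar>a * incr h (x, u)\<bar> \<le> C * D * min (norm u) ((norm u)\<^sup>2)" if "\<bar>a\<bar> \<le> C * norm u" "C \<ge> 0" for a C x u
  proof -
    have "\<bar>a * incr h (x, u)\<bar> \<le> (C * norm u) * (D * min 1 (norm u))"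
      unfolding incr_def abs_mult using D that by (intro mult_mono) auto
    also have "\<dots> = C * D * min (norm u) ((norm u)\<^sup>2)"
      by (simp add: mult_min_one[symmetric])
    finally show ?thesis .
  qed
  show ?int
  proof (rule integrable_P_bound[of _ "1 * D"])
    fix x u :: "real ^ 'd"
    show "\<bar>snd (x, u) $ j * incr h (x, u)\<bar> \<le> 1 * D * min (norm u) ((norm u)\<^sup>2)"
      using component_le_norm_cart[of u j] by (intro bound) auto
  qed measurable
  define Q1 where "Q1 = (LINT xu|P. snd xu $ j * incr h xu)"
  define C1 where "C1 = expectation (\<lambda>x. x $ j * h x)"
  have g_lim: "(\<lambda>n. g n x) \<longlonglongrightarrow> x $ j" for x
    unfolding g_def by (rule g_trunc_tendsto)
  have g_le: "\<bar>g n x\<bar> \<le> \<bar>x $ j\<bar>" for n x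
    unfolding g_def by (rule g_trunc_le)
  \<comment> \<open>The energy of \<open>g_trunc\<close> itself may blow up, but its product with
    the bounded increment of h is dominated through the constant 3, independently of n.\<close>
  have E_lim: "(\<lambda>n. E (g n) h) \<longlonglongrightarrow> Q1"
    unfolding E_def Q1_def
  proof (rule integral_dominated_convergence)
    show "integrable P (\<lambda>xu. 3 * D * min (norm (snd xu)) ((norm (snd xu))\<^sup>2))"
      by (intro integrable_mult_right integrable_min_P)
    show "AE xu in P. (\<lambda>n. incr (g n) xu * incr h xu) \<longlonglongrightarrow> snd xu $ j * incr h xu"
    proof (rule AE_I2)
      fix xu
      have "(\<lambda>n. incr (g n) xu * incr h xu) \<longlonglongrightarrow> ((fst xu + snd xu) $ j - fst xu $ j) * incr h xu"
        unfolding incr_def[of "g _"] by (intro tendsto_intros g_lim)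
      thus "(\<lambda>n. incr (g n) xu * incr h xu) \<longlonglongrightarrow> snd xu $ j * incr h xu" by simp
    qed
    fix n
    show "AE xu in P. norm (incr (g n) xu * incr h xu) \<le> 3 * D * min (norm (snd xu)) ((norm (snd xu))\<^sup>2)"
    proof (rule AE_I2)
      fix xu :: "(real ^ 'd) \<times> (real ^ 'd)"
      have "\<bar>incr (g n) xu\<bar> \<le> 3 * norm (snd xu)"
        using g_trunc_lipschitz[of "real (Suc n)" j "fst xu + snd xu" "fst xu"] by (simp add: incr_def g_def)
      from bound[OF this, of "fst xu"] show "norm (incr (g n) xu * incr h xu) \<le> 3 * D * min (norm (snd xu)) ((norm (snd xu))\<^sup>2)"
        by simp
    qed
  qed measurable
  have lim1: "(\<lambda>n. expectation (\<lambda>x. g n x * h x)) \<longlonglongrightarrow> C1"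
    unfolding C1_def
  proof (rule integral_dominated_convergence)
    show "integrable \<mu> (\<lambda>x. norm (h x * x $ j))"
      by (intro integrable_norm bl_integrable_mult[OF h int])
    show "AE x in \<mu>. (\<lambda>n. g n x * h x) \<longlonglongrightarrow> x $ j * h x"
      by (intro AE_I2 tendsto_mult_right g_lim)
    show "AE x in \<mu>. norm (g n x * h x) \<le> norm (h x * x $ j)" for n
      using g_le[of n] by (intro AE_I2) (simp add: abs_mult mult.commute mult_left_mono)
  qed measurable
  have lim2: "(\<lambda>n. expectation (g n)) \<longlonglongrightarrow> expectation (\<lambda>x. x $ j)"
  proof (rule integral_dominated_convergence)
    show "integrable \<mu> (\<lambda>x. norm (x $ j))"
      by (intro integrable_norm int)
    show "AE x in \<mu>. (\<lambda>n. g n x) \<longlonglongrightarrow> x $ j"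
      by (intro AE_I2 g_lim)
    show "AE x in \<mu>. norm (g n x) \<le> norm (x $ j)" for n
      using g_le[of n] by (intro AE_I2) simp
  qed measurable
  \<comment> \<open>Centering removes the product of expectations, leaving only the mixed
    moment.\<close>
  have Cv_lim: "(\<lambda>n. Cv (g n) h) \<longlonglongrightarrow> C1"
    unfolding Cv_def using tendsto_diff[OF lim1 tendsto_mult_right[OF lim2, of "expectation h"]]
    by (simp add: centred)
  define q where "q = Q1 - C1"
  define A where "A = E h h - Cv h h"
  have A0: "A \<ge> 0" using Cv_le_E[OF U h] by (simp add: A_def)
  have quad: "0 \<le> 2 * s * q + s\<^sup>2 * A" for s
  proof (rule LIMSEQ_le_const)
    have "(\<lambda>n. (E (g n) (g n) - Cv (g n) (g n)) + 2 * s * (E (g n) h - Cv (g n) h) + s\<^sup>2 * (E h h - Cv h h))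
        \<longlonglongrightarrow> 0 + 2 * s * (Q1 - C1) + s\<^sup>2 * (E h h - Cv h h)"
      using lim unfolding g_def[symmetric] by (intro tendsto_intros E_lim Cv_lim)
    thus "(\<lambda>n. (E (g n) (g n) - Cv (g n) (g n)) + 2 * s * (E (g n) h - Cv (g n) h) + s\<^sup>2 * (E h h - Cv h h))
        \<longlonglongrightarrow> 2 * s * q + s\<^sup>2 * A"
      by (simp add: q_def A_def)
    show "\<exists>N. \<forall>n\<ge>N. 0 \<le> (E (g n) (g n) - Cv (g n) (g n)) + 2 * s * (E (g n) h - Cv (g n) h) + s\<^sup>2 * (E h h - Cv h h)"
      using quadratic_nonneg[OF U g h] by blast
  qed
  have "q = 0"
  proof (rule ccontr)
    assume q: "q \<noteq> 0"
    \<comment> \<open>At s = - q t the quadratic equals t q^2 (t A - 2), negative since t A <= 1.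
      The summand 1 keeps t defined when A = 0.\<close>
    define t where "t = 1 / (A + 1)"
    have t: "t > 0" "t * A \<le> 1" using A0 by (auto simp: t_def)
    have "t * q\<^sup>2 * (t * A - 2) < 0"
      using t q by (intro mult_pos_neg) auto
    moreover have "2 * (- q * t) * q + (- q * t)\<^sup>2 * A = t * q\<^sup>2 * (t * A - 2)"
      by (simp add: algebra_simps power2_eq_square)
    ultimately show False using quad[of "- q * t"] by simp
  qed
  thus ?eq by (simp add: q_def Q1_def C1_def)
qed

section \<open>From the Stein-type identity to the characteristic function\<close>

lemma euler_direction:
  fixes w :: "real ^ 'd"
  assumes h: "bounded_lipschitz h" and int: "\<And>j. integrable \<mu> (\<lambda>x. x $ j)"
    and coord: "\<And>j. integrable P (\<lambda>xu. snd xu $ j * incr h xu)"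
      "\<And>j. (LINT xu|P. snd xu $ j * incr h xu) = expectation (\<lambda>x. x $ j * h x)"
  shows "(LINT xu|P. (w \<bullet> snd xu) * incr h xu) = expectation (\<lambda>x. (w \<bullet> x) * h x)"
proof -
  have "(LINT xu|P. (w \<bullet> snd xu) * incr h xu) = (LINT xu|P. (\<Sum>j\<in>UNIV. w $ j * (snd xu $ j * incr h xu)))"
    by (simp add: inner_vec_def sum_distrib_right mult.assoc)
  also have "\<dots> = (\<Sum>j\<in>UNIV. w $ j * expectation (\<lambda>x. x $ j * h x))"
    using coord by (subst Bochner_Integration.integral_sum) auto
  also have "\<dots> = expectation (\<lambda>x. (\<Sum>j\<in>UNIV. w $ j * (x $ j * h x)))"
    using bl_integrable_mult[OF h int] by (subst Bochner_Integration.integral_sum) (auto simp: mult.commute)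
  also have "\<dots> = expectation (\<lambda>x. (w \<bullet> x) * h x)"
    by (simp add: inner_vec_def sum_distrib_right mult.assoc)
  finally show ?thesis .
qed

text \<open>The addition theorem separates x from u. The part with cos - 1 is odd in u after
  multiplication by w . u and vanishes by reflection; the sine part is even and is the integral
  already computed. Writing w . u = (\<xi> . u) / s lowers the power s^\<alpha> to s^(\<alpha> -
  1).\<close>

lemma euler_cos:
  fixes w :: "real ^ 'd" and s c :: real
  assumes s: "s > 0"
  defines "h \<equiv> \<lambda>x. cos ((s *\<^sub>R w) \<bullet> x + c)"
  shows "(LINT xu|P. (w \<bullet> snd xu) * incr h xu)
     = - (\<alpha> / 2 * norm w powr \<alpha> * s powr (\<alpha> - 1)) * expectation (\<lambda>x. sin ((s *\<^sub>R w) \<bullet> x + c))"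
proof -
  define \<xi> where "\<xi> = s *\<^sub>R w"
  have w: "w \<bullet> u = (\<xi> \<bullet> u) / s" for u using s by (simp add: \<xi>_def)
  obtain D where D: "D \<ge> 0" "\<And>x u. \<bar>cos (\<xi> \<bullet> (x + u) + 0) - cos (\<xi> \<bullet> x + 0)\<bar> \<le> D * min 1 (norm u)"
    using bounded_lipschitz_increment[OF bounded_lipschitz_cos[of \<xi> 0]] by blast
  have cm: "integrable \<mu> (\<lambda>x. cos (\<xi> \<bullet> x + c))" by (intro integrable_const_bound[of _ 1]) auto
  have sm: "integrable \<mu> (\<lambda>x. sin (\<xi> \<bullet> x + c))" by (intro integrable_const_bound[of _ 1]) auto
  have cl: "integrable (stable_levy \<alpha>) (\<lambda>u. (w \<bullet> u) * (cos (\<xi> \<bullet> u) - 1))"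
  proof (rule Bochner_Integration.integrable_bound)
    show "integrable (stable_levy \<alpha>) (\<lambda>u::real ^ 'd. (norm w * D) * min (norm u) ((norm u)\<^sup>2))"
      by (intro integrable_mult_right stable_levy_integrable_min \<alpha>)
    show "AE u in stable_levy \<alpha>. norm ((w \<bullet> u) * (cos (\<xi> \<bullet> u) - 1)) \<le> norm ((norm w * D) * min (norm u) ((norm u)\<^sup>2))"
    proof (rule AE_I2)
      fix u
      have "norm ((w \<bullet> u) * (cos (\<xi> \<bullet> u) - 1)) \<le> (norm w * norm u) * (D * min 1 (norm u))"
        unfolding real_norm_def abs_mult using D(2)[of 0 u] D(1) Cauchy_Schwarz_ineq2[of w u]
        by (intro mult_mono) auto
      also have "\<dots> = (norm w * D) * min (norm u) ((norm u)\<^sup>2)"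
        by (simp add: mult_min_one[symmetric])
      finally show "norm ((w \<bullet> u) * (cos (\<xi> \<bullet> u) - 1)) \<le> norm ((norm w * D) * min (norm u) ((norm u)\<^sup>2))"
        by simp
    qed
  qed simp
  have sl: "integrable (stable_levy \<alpha>) (\<lambda>u. (w \<bullet> u) * sin (\<xi> \<bullet> u))"
    unfolding w using integrable_divide[OF integrable_stable_levy_x_sin[OF \<alpha>, of \<xi>], of s] by simp
  have "(w \<bullet> snd xu) * incr h xu = cos (\<xi> \<bullet> fst xu + c) * ((w \<bullet> snd xu) * (cos (\<xi> \<bullet> snd xu) - 1))
      - sin (\<xi> \<bullet> fst xu + c) * ((w \<bullet> snd xu) * sin (\<xi> \<bullet> snd xu))" for xu
  proof -
    define a b where "a = \<xi> \<bullet> fst xu + c" and "b = \<xi> \<bullet> snd xu"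
    have 1: "h (fst xu + snd xu) = cos (a + b)"
      by (simp add: h_def a_def b_def \<xi>_def inner_add_right algebra_simps)
    have 2: "h (fst xu) = cos a" by (simp add: h_def a_def \<xi>_def)
    show ?thesis
      unfolding incr_def 1 2 cos_add a_def[symmetric] b_def[symmetric] by (simp add: algebra_simps)
  qed
  hence "(LINT xu|P. (w \<bullet> snd xu) * incr h xu)
     = (LINT xu|P. cos (\<xi> \<bullet> fst xu + c) * ((w \<bullet> snd xu) * (cos (\<xi> \<bullet> snd xu) - 1)))
      - (LINT xu|P. sin (\<xi> \<bullet> fst xu + c) * ((w \<bullet> snd xu) * sin (\<xi> \<bullet> snd xu)))"
    using integrable_prod_mult[OF cm cl] integrable_prod_mult[OF sm sl] by (simp add: case_prod_unfold)
  also have "(LINT xu|P. cos (\<xi> \<bullet> fst xu + c) * ((w \<bullet> snd xu) * (cos (\<xi> \<bullet> snd xu) - 1)))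
      = expectation (\<lambda>x. cos (\<xi> \<bullet> x + c)) * (LINT u|stable_levy \<alpha>. (w \<bullet> u) * (cos (\<xi> \<bullet> u) - 1))"
    by (rule integral_prod_mult[OF cm cl])
  also have "(LINT u|stable_levy \<alpha>. (w \<bullet> u) * (cos (\<xi> \<bullet> u) - 1)) = 0"
    using stable_levy_integral_reflect[OF \<alpha>, of "\<lambda>u. (w \<bullet> u) * (cos (\<xi> \<bullet> u) - 1)"] by simp
  also have "(LINT xu|P. sin (\<xi> \<bullet> fst xu + c) * ((w \<bullet> snd xu) * sin (\<xi> \<bullet> snd xu)))
      = expectation (\<lambda>x. sin (\<xi> \<bullet> x + c)) * (LINT u|stable_levy \<alpha>. (w \<bullet> u) * sin (\<xi> \<bullet> u))"
    by (rule integral_prod_mult[OF sm sl])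
  also have "(LINT u|stable_levy \<alpha>. (w \<bullet> u) * sin (\<xi> \<bullet> u)) = (\<alpha> / 2 * norm \<xi> powr \<alpha>) / s"
    unfolding w stable_levy_x_sin_integral[OF \<alpha>, symmetric] by simp
  also have "norm \<xi> powr \<alpha> = s powr \<alpha> * norm w powr \<alpha>"
    using s by (simp add: \<xi>_def powr_mult)
  also have "\<alpha> / 2 * (s powr \<alpha> * norm w powr \<alpha>) / s = \<alpha> / 2 * norm w powr \<alpha> * s powr (\<alpha> - 1)"
    using s by (simp add: powr_diff)
  finally show ?thesis by (simp add: \<xi>_def)
qed

lemma char_vec_eq:
  fixes w :: "real ^ 'd"
  assumes int: "\<And>j. integrable \<mu> (\<lambda>x. x $ j)"
    and coord: "\<And>j h. bounded_lipschitz h \<Longrightarrow> integrable P (\<lambda>xu. snd xu $ j * incr h xu)"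
      "\<And>j h. bounded_lipschitz h \<Longrightarrow> (LINT xu|P. snd xu $ j * incr h xu) = expectation (\<lambda>x. x $ j * h x)"
  shows "char_vec \<mu> w = complex_of_real (exp (- (norm w powr \<alpha>) / 2))"
proof -
  \<comment> \<open>The factors 1 in \<phi> and D present them as Fourier integrals with constant
    weight 1, so that the differentiation lemma applies verbatim.\<close>
  define \<phi> where "\<phi> s = (CLINT x|\<mu>. 1 *\<^sub>R iexp (s * (w \<bullet> x)))" for s
  define D where "D s = (CLINT x|\<mu>. (1 * (w \<bullet> x)) *\<^sub>R (\<i> * iexp (s * (w \<bullet> x))))" for s
  have wint: "integrable \<mu> (\<lambda>x. w \<bullet> x)"
    unfolding inner_vec_def using int by auto
  have der: "(\<phi> has_vector_derivative D s) (at s)" for s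
    unfolding \<phi>_def[abs_def] D_def
    using wint by (intro has_vector_derivative_fourier_integral) auto
  have pint: "integrable \<mu> (\<lambda>x. iexp (s * (w \<bullet> x)))" for s
    by (rule integrable_const_bound[of _ 1]) auto
  have dint: "integrable \<mu> (\<lambda>x. (1 * (w \<bullet> x)) *\<^sub>R (\<i> * iexp (s * (w \<bullet> x))))" for s
    by (rule Bochner_Integration.integrable_bound[OF wint]) (auto simp: norm_mult)
  define k where "k s = \<alpha> / 2 * norm w powr \<alpha> * s powr (\<alpha> - 1)" for s
  have euler: "expectation (\<lambda>x. (w \<bullet> x) * cos (s * (w \<bullet> x) + c)) = - k s * expectation (\<lambda>x. sin (s * (w \<bullet> x) + c))"
    if s: "s > 0" for s c
    using euler_direction[OF bounded_lipschitz_cos int coord[OF bounded_lipschitz_cos], of w "s *\<^sub>R w" c]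
      euler_cos[OF s, of w c] by (simp add: k_def)
  have ode: "D s = - k s *\<^sub>R \<phi> s" if s: "s > 0" for s
  proof (rule complex_eqI)
    have "Re (D s) = expectation (\<lambda>x. - ((w \<bullet> x) * sin (s * (w \<bullet> x))))"
      unfolding D_def by (subst integral_Re[OF dint, symmetric]) (simp add: Im_exp)
    \<comment> \<open>A phase of - pi / 2 turns the sine into a cosine, so cosine test functions
      yield the real part too; phase 0 yields the imaginary part.\<close>
    also have "\<dots> = - expectation (\<lambda>x. (w \<bullet> x) * cos (s * (w \<bullet> x) + - (pi / 2)))"
      by (simp add: cos_diff)
    also have "\<dots> = - k s * expectation (\<lambda>x. cos (s * (w \<bullet> x)))"
      unfolding euler[OF s] by (simp add: sin_diff)
    also have "expectation (\<lambda>x. cos (s * (w \<bullet> x))) = Re (\<phi> s)"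
      unfolding \<phi>_def scaleR_one by (subst integral_Re[OF pint, symmetric]) (simp add: Re_exp)
    finally show "Re (D s) = Re (- k s *\<^sub>R \<phi> s)" by simp
    have "Im (D s) = expectation (\<lambda>x. (w \<bullet> x) * cos (s * (w \<bullet> x) + 0))"
      unfolding D_def by (subst integral_Im[OF dint, symmetric]) (simp add: Re_exp)
    also have "\<dots> = - k s * expectation (\<lambda>x. sin (s * (w \<bullet> x)))"
      unfolding euler[OF s] by simp
    also have "expectation (\<lambda>x. sin (s * (w \<bullet> x))) = Im (\<phi> s)"
      unfolding \<phi>_def scaleR_one by (subst integral_Im[OF pint, symmetric]) (simp add: Im_exp)
    finally show "Im (D s) = Im (- k s *\<^sub>R \<phi> s)" by simp
  qed
  \<comment> \<open>The integrating factor: e' = k e makes the derivative of e \<phi> vanish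
    wherever the differential equation holds.\<close>
  define e where "e s = exp (norm w powr \<alpha> / 2 * s powr \<alpha>)" for s :: real
  have der_e: "(e has_real_derivative k s * e s) (at s)" if "s > 0" for s
    unfolding e_def k_def using that \<alpha> by (auto intro!: derivative_eq_intros simp: powr_diff)
  have "e 1 *\<^sub>R \<phi> 1 = 1"
  \<comment> \<open>The equation is known only for s > 0. Continuity on the closed interval allows
    the single exceptional point 0, where e \<phi> has the value 1 because 0 powr \<alpha> is
    0.\<close>
  proof (rule has_derivative_zero_unique_strong_interval[where k = "{0}" and a = 0 and b = 1])
    have "continuous_on {0..1} \<phi>"
      using der has_vector_derivative_continuous by (intro continuous_at_imp_continuous_on) blast
    moreover have "continuous_on {0..1} e"
      unfolding e_def using \<alpha> by (intro continuous_intros continuous_on_powr') auto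
    ultimately show "continuous_on {0..1} (\<lambda>s. e s *\<^sub>R \<phi> s)" by (intro continuous_intros)
    show "e 0 *\<^sub>R \<phi> 0 = 1" using \<alpha> by (simp add: e_def \<phi>_def prob_space[unfolded space_\<mu>])
    fix s :: real
    assume "s \<in> {0..1} - {0}"
    hence s: "s > 0" by simp
    have "((\<lambda>s. e s *\<^sub>R \<phi> s) has_vector_derivative e s *\<^sub>R D s + (k s * e s) *\<^sub>R \<phi> s) (at s)"
      by (intro has_vector_derivative_scaleR der der_e s)
    also have "e s *\<^sub>R D s + (k s * e s) *\<^sub>R \<phi> s = 0" by (simp add: ode[OF s])
    finally show "((\<lambda>s. e s *\<^sub>R \<phi> s) has_derivative (\<lambda>h. 0)) (at s within {0..1})"
      by (auto simp: has_vector_derivative_def intro: has_derivative_at_withinI)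
  qed auto
  hence "\<phi> 1 = 1 /\<^sub>R e 1" by (simp add: e_def) (metis (no_types, lifting) exp_not_eq_zero scaleR_one scaleR_left_commute left_inverse scaleR_scaleR)
  thus ?thesis
    by (simp add: char_vec_def \<phi>_def e_def exp_minus scaleR_conv_of_real)
qed

end

theorem corollary5p2:
  fixes \<alpha> :: real and M :: "'a measure" and X :: "'a \<Rightarrow> real ^ 'd"
    and \<mu> :: "(real ^ 'd) measure"
  assumes "1 < \<alpha>" and "\<alpha> < 2"
    and "prob_space M"
    and "X \<in> borel_measurable M"
    and "integrable M X"
    and "prob_space.expectation M X = 0"
    and "\<mu> = distr M borel X"
    and "\<forall>j. ((\<lambda>R. ereal (prob_space.variance \<mu> (g_trunc R j))
                  - enn2ereal (energy \<alpha> \<mu> (g_trunc R j))) \<longlongrightarrow> 0) at_top"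
    and "U_functional \<alpha> \<mu> = 1"
  shows "\<mu> = stable_law \<alpha>"
proof -
  interpret M: prob_space M by fact
  note [measurable] = assms(4)
  interpret stable_form \<mu> \<alpha>
    unfolding assms(7) by (intro stable_form.intro stable_form_axioms.intro M.prob_space_distr assms(1,2)) auto
  have id: "integrable \<mu> (\<lambda>x. x)" "expectation (\<lambda>x. x) = 0"
    using assms(5,6) by (simp_all add: assms(7) integrable_distr_eq integral_distr)
  have int: "integrable \<mu> (\<lambda>x. x $ j)" for j
    using integrable_bounded_linear[OF bounded_linear_vec_nth id(1)] .
  have centred: "expectation (\<lambda>x. x $ j) = 0" for j
    using integral_bounded_linear[OF bounded_linear_vec_nth id(1), of j] id(2) by simp
  have lim: "(\<lambda>n. E (g_trunc (real (Suc n)) j) (g_trunc (real (Suc n)) j)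
        - Cv (g_trunc (real (Suc n)) j) (g_trunc (real (Suc n)) j)) \<longlonglongrightarrow> 0" for j
  proof -
    have g: "bounded_lipschitz (g_trunc (real (Suc n)) j)" for n
      by (rule bounded_lipschitz_g_trunc) simp
    \<comment> \<open>The radii n + 1 run to infinity and are all positive, as the Lipschitz bound
      for \<open>g_trunc\<close> demands.\<close>
    have "(\<lambda>n. ereal (variance (g_trunc (real (Suc n)) j)) - enn2ereal (energy \<alpha> \<mu> (g_trunc (real (Suc n)) j))) \<longlonglongrightarrow> 0"
      using filterlim_compose[OF assms(8)[rule_format, of j] filterlim_compose[OF filterlim_real_sequentially filterlim_Suc]] .
    \<comment> \<open>Variance and energy are finite here, so the extended difference is a real one;
      its sign is opposite to that of Q and is reversed afterwards.\<close>
    hence "(\<lambda>n. ereal (Cv (g_trunc (real (Suc n)) j) (g_trunc (real (Suc n)) j) - E (g_trunc (real (Suc n)) j) (g_trunc (real (Suc n)) j))) \<longlonglongrightarrow> ereal 0"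
      by (simp only: variance_eq_Cv[OF g] energy_eq[OF g] enn2ereal_ennreal[OF E_nonneg] ereal_minus zero_ereal_def)
    hence "(\<lambda>n. - (Cv (g_trunc (real (Suc n)) j) (g_trunc (real (Suc n)) j) - E (g_trunc (real (Suc n)) j) (g_trunc (real (Suc n)) j))) \<longlonglongrightarrow> - 0"
      unfolding lim_ereal by (rule tendsto_minus)
    thus ?thesis by simp
  qed
  have cv: "char_vec \<mu> \<xi> = complex_of_real (exp (- (norm \<xi> powr \<alpha>) / 2))" for \<xi>
    using int integrable_coord_incr[OF assms(9) _ int centred lim] euler_coord[OF assms(9) _ int centred lim]
    by (rule char_vec_eq)
  show ?thesis
    unfolding stable_law_def
  \<comment> \<open>The law of X itself satisfies the description, so no separate construction of a
    stable law is made; any other candidate has the same transform.\<close>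
  proof (rule the_equality[symmetric])
    show "prob_space \<mu> \<and> sets \<mu> = sets borel \<and> (\<forall>\<xi>. char_vec \<mu> \<xi> = complex_of_real (exp (- (norm \<xi> powr \<alpha>) / 2)))"
      using cv prob_space_axioms by simp
    fix \<nu> :: "(real ^ 'd) measure"
    assume \<nu>: "prob_space \<nu> \<and> sets \<nu> = sets borel \<and> (\<forall>\<xi>. char_vec \<nu> \<xi> = complex_of_real (exp (- (norm \<xi> powr \<alpha>) / 2)))"
    show "\<nu> = \<mu>"
    proof (rule measure_eqI_fourier)
      show "finite_measure \<nu>" using \<nu> by (simp add: prob_space_def)
      show "finite_measure \<mu>" by (rule finite_measure_axioms)
      show "(CLINT x|\<nu>. iexp (\<xi> \<bullet> x)) = (CLINT x|\<mu>. iexp (\<xi> \<bullet> x))" for \<xi>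
        using \<nu> cv[of \<xi>] unfolding char_vec_def by simp
    qed (use \<nu> in auto)
  qed
qed

end
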